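(* Let $\Gamma$ be a finitely generated countably infinite amenable group with a finite symmetric generating set $S$ not containing the identity $e$, and let $n\ge 2$ be an integer. Let $\mathcal{G}$ be the Schreier graph (with respect to $S$) induced by the free part of the shift action $\Gamma \curvearrowright n^\Gamma$, and let $A_e(\Gamma)=\{\gamma\in \operatorname{Aut}(\operatorname{Cay}(\Gamma,S)) \mid \gamma(e)=e\}$. (1) If $A_e(\Gamma)$ is trivial, then $D_B(\mathcal{G})=n$. (2) If $A_e(\Gamma)$ is non-trivial, then $D_B(\mathcal{G})\ge n+1$.
   Context: Here $n=\{0,\dots,n-1\}$ is a discrete alphabet and $n^\Gamma$ carries the product Borel structure. The shift action is $(g\cdot x)(h)=x(hg)$. The free part is $X=\{x\in n^\Gamma : g\cdot x\neq x \text{ for all } g\in\Gamma\setminus\{e\}\}$. The Schreier graph $\mathcal{G}=(X,E)$ has vertex set $X$ and edges $x\,E\,y \iff x\neq y$ and $s\cdot x=y$ for some $s\in S$. The Cayley graph $\operatorname{Cay}(\Gamma,S)$ has vertex set $\Gamma$, with distinct $g,h$ adjacent iff $g=sh$ for some $s\in S$; $\operatorname{Aut}$ denotes the group of all graph automorphisms. $\Gamma$ is amenable if there is a sequence of non-empty finite sets $F_m\subseteq\Gamma$ with $|gF_m\triangle F_m|/|F_m|\to 0$ for every $g\in\Gamma$. For a Borel graph $\mathcal{G}=(X,E)$ ($X$ a standard Borel space, $E\subseteq X\times X$ Borel, symmetric, irreflexive), a Borel distinguishing $Y$-coloring is a Borel map $c:X\to Y$ into a standard Borel space $Y$ such that $c\circ\psi\neq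 c$ for every non-identity graph automorphism $\psi$ of $\mathcal{G}$ (not necessarily Borel). The Borel distinguishing number $D_B(\mathcal{G})$ is the minimum cardinality $|Y|$ of a standard Borel space $Y$ for which a Borel distinguishing $Y$-coloring exists. *)

theory Defs
  imports "HOL-Analysis.Analysis" "HOL-Algebra.Algebra"
begin

unbundle cardinal_syntax

section \<open>Borel distinguishing colorings\<close>

text \<open>Vertex spaces and color spaces are measurable spaces, represented by the type
  \<^typ>\<open>'a measure\<close>; only the underlying set and sigma-algebra are ever used.\<close>

definition standard_borel_space :: "'a measure \<Rightarrow> bool" where
  "standard_borel_space M \<longleftrightarrow>
     (\<exists>T. completely_metrizable_space T \<and> second_countable T \<and> topspace T = space M \<and>
          sets M = sigma_sets (space M) {U. openin T U})"

text \<open>Following \<^const>\<open>Bij\<close>, automorphisms are extensional (\<^term>\<open>undefined\<close> off \<open>V\<close>), so that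
  the identity automorphism is \<^term>\<open>\<lambda>x\<in>V. x\<close>.\<close>

definition graph_aut :: "'v set \<Rightarrow> 'v rel \<Rightarrow> ('v \<Rightarrow> 'v) set" where
  "graph_aut V E =
     {\<psi> \<in> Bij V. \<forall>x\<in>V. \<forall>y\<in>V. (\<psi> x, \<psi> y) \<in> E \<longleftrightarrow> (x, y) \<in> E}"

definition borel_distinguishing_coloring ::
    "'v measure \<Rightarrow> 'v rel \<Rightarrow> 'y measure \<Rightarrow> ('v \<Rightarrow> 'y) \<Rightarrow> bool" where
  "borel_distinguishing_coloring M E Y c \<longleftrightarrow>
     standard_borel_space Y \<and> c \<in> M \<rightarrow>\<^sub>M Y \<and>
     (\<forall>\<psi> \<in> graph_aut (space M) E. \<psi> \<noteq> (\<lambda>x\<in>space M. x) \<longrightarrow>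
        (\<exists>x\<in>space M. c (\<psi> x) \<noteq> c x))"

text \<open>The value is a cardinal in the sense of \<open>HOL.BNF_Cardinal_Order_Relation\<close>, determined
  up to \<open>=o\<close>. Color spaces are taken on subsets of \<^typ>\<open>real\<close> because HOL cannot quantify over
  types; since standard Borel spaces have at most continuum many points this is no
  restriction, as shown by \<open>borel_distinguishing_number_le\<close> below.\<close>

definition borel_distinguishing_number :: "'v measure \<Rightarrow> 'v rel \<Rightarrow> real rel" where
  "borel_distinguishing_number M E =
     (SOME \<kappa>. (\<exists>(Y :: real measure) c. borel_distinguishing_coloring M E Y c \<and> \<kappa> = |space Y| ) \<and>
              (\<forall>(Y :: real measure) c. borel_distinguishing_coloring M E Y c \<longrightarrow> \<kappa> \<le>o |space Y| ))"

lemma standard_borel_space_inj_real: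
  fixes Y :: "'y measure"
  assumes "standard_borel_space Y"
  shows "\<exists>i :: 'y \<Rightarrow> real. inj_on i (space Y)"
proof -
  obtain T where T: "completely_metrizable_space T" "second_countable T" "topspace T = space Y"
    using assms unfolding standard_borel_space_def by blast
  have haus: "Hausdorff_space T"
    using T(1) completely_metrizable_imp_metrizable_space metrizable_imp_Hausdorff_space by blast
  obtain B where B: "countable B" "\<forall>V\<in>B. openin T V"
      "\<And>U x. openin T U \<and> x \<in> U \<Longrightarrow> \<exists>V\<in>B. x \<in> V \<and> V \<subseteq> U"
    using T(2) unfolding second_countable_def by metis
  define j where "j = (\<lambda>x. to_nat_on B ` {V\<in>B. x \<in> V})"
  have "inj_on j (space Y)"
  proof (rule inj_onI, rule ccontr)
    fix x y assume xy: "x \<in> space Y" "y \<in> space Y" "j x = j y" "x \<noteq> y"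
    obtain U W where "openin T U" "openin T W" "x \<in> U" "y \<in> W" "disjnt U W"
      using haus xy T(3) unfolding Hausdorff_space_def by metis
    then obtain V where V: "V \<in> B" "x \<in> V" "y \<notin> V"
      using B(3)[of U x] unfolding disjnt_def by blast
    then have "to_nat_on B V \<in> j y"
      using xy(3) unfolding j_def by blast
    then obtain V' where "V' \<in> B" "y \<in> V'" "to_nat_on B V' = to_nat_on B V"
      unfolding j_def by fastforce
    then show False
      using V inj_on_to_nat_on[OF B(1)] unfolding inj_on_def by blast
  qed
  moreover obtain r :: "nat set \<Rightarrow> real" where "inj r"
    using nat_sets_lepoll_reals01 unfolding lepoll_def by blast
  ultimately have "inj_on (r \<circ> j) (space Y)"
    by (meson comp_inj_on inj_on_subset top_greatest)
  then show ?thesis by blast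
qed

lemma borel_distinguishing_coloring_real:
  fixes Y :: "'y measure"
  assumes "borel_distinguishing_coloring M E Y c"
  shows "\<exists>(Y' :: real measure) c'. borel_distinguishing_coloring M E Y' c' \<and> |space Y'| =o |space Y|"
proof -
  have sb: "standard_borel_space Y" and c: "c \<in> M \<rightarrow>\<^sub>M Y"
    and d: "\<forall>\<psi> \<in> graph_aut (space M) E. \<psi> \<noteq> (\<lambda>x\<in>space M. x) \<longrightarrow> (\<exists>x\<in>space M. c (\<psi> x) \<noteq> c x)"
    using assms unfolding borel_distinguishing_coloring_def by auto
  obtain i :: "'y \<Rightarrow> real" where i: "inj_on i (space Y)"
    using standard_borel_space_inj_real[OF sb] by blast
  obtain T where T: "completely_metrizable_space T" "second_countable T" "topspace T = space Y"
      "sets Y = sigma_sets (space Y) {U. openin T U}"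
    using sb unfolding standard_borel_space_def by blast
  let ?R = "i ` space Y"
  define T' where "T' = pullback_topology ?R (inv_into (space Y) i) T"
  have top': "topspace T' = ?R"
    unfolding T'_def topspace_pullback_topology using i T(3) by auto
  have open': "openin T' W \<longleftrightarrow> (\<exists>U. openin T U \<and> W = i ` U)" for W
  proof -
    have "inv_into (space Y) i -` U \<inter> ?R = i ` U" if "openin T U" for U
    proof -
      have U: "U \<subseteq> space Y" using openin_subset[OF that] T(3) by simp
      show ?thesis using U i by (auto simp: inv_into_f_f subset_iff image_iff)
    qed
    then show ?thesis unfolding T'_def openin_pullback_topology by metis
  qed
  have "homeomorphic_map T T' i"
    unfolding homeomorphic_map_def quotient_map_def
  proof (intro conjI allI impI)
    show "i ` topspace T = topspace T'" using top' T(3) by simp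
    show "inj_on i (topspace T)" using i T(3) by simp
    fix U assume U: "U \<subseteq> topspace T'"
    let ?P = "{x \<in> topspace T. i x \<in> U}"
    have img: "i ` ?P = U" using U top' T(3) by auto
    show "openin T ?P \<longleftrightarrow> openin T' U"
    proof
      assume "openin T ?P" then show "openin T' U" using open' img by metis
    next
      assume "openin T' U"
      then obtain V where V: "openin T V" "U = i ` V" using open' by blast
      have "V \<subseteq> space Y" using openin_subset[OF V(1)] T(3) by simp
      then have "?P = V" using V(2) i T(3) by (auto simp: inj_on_def)
      then show "openin T ?P" using V(1) by simp
    qed
  qed
  then have hom: "T homeomorphic_space T'"
    using homeomorphic_map_imp_homeomorphic_space by blast
  define Y' where "Y' = sigma ?R {U. openin T' U}"
  have sub: "{U. openin T' U} \<subseteq> Pow ?R" using openin_subset top' by blast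
  have sp: "space Y' = ?R" unfolding Y'_def using sub by (rule space_measure_of)
  have st: "sets Y' = sigma_sets ?R {U. openin T' U}"
    unfolding Y'_def using sub by (rule sets_measure_of)
  have sb': "standard_borel_space Y'"
    unfolding standard_borel_space_def
    using T hom top' sp st homeomorphic_completely_metrizable_space
      homeomorphic_space_second_countability by metis
  have im: "i \<in> Y \<rightarrow>\<^sub>M Y'"
    unfolding Y'_def
  proof (rule measurable_measure_of[OF sub])
    show "i \<in> space Y \<rightarrow> ?R" by auto
    fix W assume "W \<in> {U. openin T' U}"
    then obtain U where U: "openin T U" "W = i ` U" using open' by blast
    have "U \<subseteq> space Y" using openin_subset[OF U(1)] T(3) by simp
    then have "i -` W \<inter> space Y = U" using U(2) i by (auto simp: inj_on_def)
    then show "i -` W \<inter> space Y \<in> sets Y" using U(1) T(4) by auto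
  qed
  have "borel_distinguishing_coloring M E Y' (i \<circ> c)"
    unfolding borel_distinguishing_coloring_def
  proof (intro conjI ballI impI sb' measurable_comp[OF c im])
    fix \<psi> assume p: "\<psi> \<in> graph_aut (space M) E" "\<psi> \<noteq> (\<lambda>x\<in>space M. x)"
    then obtain x where x: "x \<in> space M" "c (\<psi> x) \<noteq> c x" using d by blast
    have "\<psi> x \<in> space M" using p(1) x(1) Bij_imp_funcset unfolding graph_aut_def by blast
    then have "(i \<circ> c) (\<psi> x) \<noteq> (i \<circ> c) x"
      using x i measurable_space[OF c] by (auto simp: inj_on_def)
    then show "\<exists>x\<in>space M. (i \<circ> c) (\<psi> x) \<noteq> (i \<circ> c) x" using x(1) by blast
  qed
  moreover have "|space Y'| =o |space Y|"
    using i sp card_of_ordIsoI ordIso_symmetric unfolding bij_betw_def by metis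
  ultimately show ?thesis by blast
qed

lemma borel_distinguishing_number_props:
  assumes "borel_distinguishing_coloring M E (Y0 :: real measure) c0"
  shows "(\<exists>(Y :: real measure) c. borel_distinguishing_coloring M E Y c \<and>
            borel_distinguishing_number M E = |space Y| ) \<and>
         (\<forall>(Y :: real measure) c. borel_distinguishing_coloring M E Y c \<longrightarrow>
            borel_distinguishing_number M E \<le>o |space Y| )"
  unfolding borel_distinguishing_number_def
proof (rule someI_ex)
  let ?R = "{ |space Y| | (Y :: real measure) c. borel_distinguishing_coloring M E Y c}"
  have "?R \<noteq> {}" "\<forall>r\<in>?R. Card_order r" using assms card_of_Card_order by blast+
  then have "\<exists>r\<in>?R. \<forall>r'\<in>?R. r \<le>o r'" by (rule exists_minim_Card_order)
  then show "\<exists>\<kappa>. (\<exists>(Y :: real measure) c. borel_distinguishing_coloring M E Y c \<and> \<kappa> = |space Y| ) \<and>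
              (\<forall>(Y :: real measure) c. borel_distinguishing_coloring M E Y c \<longrightarrow> \<kappa> \<le>o |space Y| )"
    by blast
qed

theorem borel_distinguishing_number_le:
  assumes "borel_distinguishing_coloring M E (Y :: 'y measure) c"
  shows "borel_distinguishing_number M E \<le>o |space Y|"
  using borel_distinguishing_coloring_real[OF assms] borel_distinguishing_number_props
    ordLeq_ordIso_trans by blast


section \<open>Groups, Cayley graphs and the shift\<close>

definition amenable_group :: "('g, 'b) monoid_scheme \<Rightarrow> bool" where
  "amenable_group G \<longleftrightarrow>
     (\<exists>F :: nat \<Rightarrow> 'g set.
        (\<forall>m. F m \<subseteq> carrier G \<and> finite (F m) \<and> F m \<noteq> {}) \<and>
        (\<forall>g\<in>carrier G.
           (\<lambda>m. real (card (sym_diff (g <#\<^bsub>G\<^esub> F m) (F m))) / real (card (F m))) \<longlonglongrightarrow> 0))"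

definition cayley_edges :: "('g, 'b) monoid_scheme \<Rightarrow> 'g set \<Rightarrow> 'g rel" where
  "cayley_edges G S =
     {(g, h). g \<in> carrier G \<and> h \<in> carrier G \<and> g \<noteq> h \<and> (\<exists>s\<in>S. g = s \<otimes>\<^bsub>G\<^esub> h)}"

definition cayley_stabilizer :: "('g, 'b) monoid_scheme \<Rightarrow> 'g set \<Rightarrow> ('g \<Rightarrow> 'g) set" where
  "cayley_stabilizer G S =
     {\<gamma> \<in> graph_aut (carrier G) (cayley_edges G S). \<gamma> \<one>\<^bsub>G\<^esub> = \<one>\<^bsub>G\<^esub>}"

definition full_shift :: "('g, 'b) monoid_scheme \<Rightarrow> nat \<Rightarrow> ('g \<Rightarrow> nat) measure" where
  "full_shift G n = (\<Pi>\<^sub>M h\<in>carrier G. count_space {..<n})"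

definition shift :: "('g, 'b) monoid_scheme \<Rightarrow> 'g \<Rightarrow> ('g \<Rightarrow> nat) \<Rightarrow> ('g \<Rightarrow> nat)" where
  "shift G g x = (\<lambda>h\<in>carrier G. x (h \<otimes>\<^bsub>G\<^esub> g))"

definition free_part :: "('g, 'b) monoid_scheme \<Rightarrow> nat \<Rightarrow> ('g \<Rightarrow> nat) set" where
  "free_part G n =
     {x \<in> space (full_shift G n). \<forall>g \<in> carrier G - {\<one>\<^bsub>G\<^esub>}. shift G g x \<noteq> x}"

definition free_part_space :: "('g, 'b) monoid_scheme \<Rightarrow> nat \<Rightarrow> ('g \<Rightarrow> nat) measure" where
  "free_part_space G n = restrict_space (full_shift G n) (free_part G n)"

definition schreier_edges :: "('g, 'b) monoid_scheme \<Rightarrow> 'g set \<Rightarrow> nat \<Rightarrow> ('g \<Rightarrow> nat) rel" where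
  "schreier_edges G S n =
     {(x, y). x \<in> free_part G n \<and> y \<in> free_part G n \<and> x \<noteq> y \<and> (\<exists>s\<in>S. shift G s x = y)}"

end

(* Write mu for the uniform Bernoulli measure on n^Gamma and f(x)(g) = c(g.x) for the equivariant
   map coded by a Borel coloring c of the free part with at most n colors. If c is distinguishing,
   then f is injective, since two points with the same image would give a color-preserving swap of
   their orbits. An injective equivariant map preserves entropy, and mu is the unique shift-invariant
   measure of maximal entropy log n on n^Gamma, so f maps mu to mu; in particular no color is unused.
   Moreover f(X) has full measure, and precomposition with an automorphism gamma of the Cayley graph
   fixing the identity preserves mu, so some x, x' satisfy f(x) o gamma = f(x'). This
   gives a color-preserving isomorphism between the orbits of x' and x, which is trivial only if
   gamma is. Conversely, if gamma = id is the only choice, automorphisms of the Schreier graph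
   commute with the action and x |-> x(e) is distinguishing. *)

theory Submission
  imports Defs "HOL-Probability.Independent_Family" "HOL-Real_Asymp.Real_Asymp"
begin

section \<open>Uniform Bernoulli measures\<close>

text \<open>The entropy comparison is carried out on a single finite set. If f x determines x up to
  few errors, then the independent uniform symbols of x on a Folner set F can be recovered from f x
  on a slightly larger set, and Gibbs' inequality forbids describing these data, corrections
  included, in fewer than |F| ln n nats on average. A pattern that is too frequent in f x would
  allow a saving proportional to |F|. So no cylinder gets more than its uniform mass under the image
  law, and since these masses add up to 1 all the inequalities are equalities. The argument stays
  finite because injectivity yields, at the price of a small error probability, a decoder that reads
  only finitely many coordinates of f x. Automorphisms need not be Borel, so a single pair of orbits
  may be exchanged while everything else stays fixed; hence f is injective on the whole free part
  and not merely almost everywhere. Both claims come from one statement about colorings with at most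
  n colors: such a coloring uses exactly n, and the stabilizer is trivial.\<close>

lemma (in finite_measure) integrable_compose_count_space:
  fixes h :: "'b \<Rightarrow> real"
  assumes "finite A" "g \<in> M \<rightarrow>\<^sub>M count_space A"
  shows "integrable M (\<lambda>x. h (g x))"
proof (rule integrable_const_bound)
  have "\<bar>h a\<bar> \<le> (\<Sum>a\<in>A. \<bar>h a\<bar>)" if "a \<in> A" for a
    using assms(1) that by (intro member_le_sum) auto
  then show "AE x in M. norm (h (g x)) \<le> (\<Sum>a\<in>A. \<bar>h a\<bar>)"
    using measurable_space[OF assms(2)] by (intro AE_I2) auto
  show "(\<lambda>x. h (g x)) \<in> borel_measurable M"
    by (rule measurable_compose[OF assms(2)]) simp
qed

lemma (in finite_measure) integrable_compose_count_space2:
  fixes h :: "'b \<Rightarrow> 'c \<Rightarrow> real"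
  assumes "finite A" "finite B" "f \<in> M \<rightarrow>\<^sub>M count_space A" "g \<in> M \<rightarrow>\<^sub>M count_space B"
  shows "integrable M (\<lambda>x. h (f x) (g x))"
proof -
  have "(\<lambda>x. (f x, g x)) \<in> M \<rightarrow>\<^sub>M count_space (A \<times> B)"
    using measurable_Pair[OF assms(3,4)] assms(1,2) by (simp add: pair_measure_count_space)
  from integrable_compose_count_space[OF _ this, of "\<lambda>(a, b). h a b"] assms(1,2)
  show ?thesis by simp
qed

text \<open>The sigma-algebra is that of \<open>full_shift\<close> (see
  \<open>sets_bernoulli\<close>), which is built from counting measures; this is the measure \<mu>
  put on the Borel space of the shift.\<close>

definition bernoulli :: "'i set \<Rightarrow> nat \<Rightarrow> ('i \<Rightarrow> nat) measure" where
  "bernoulli I n = PiM I (\<lambda>_. uniform_count_measure {..<n})"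

lemma space_bernoulli: "space (bernoulli I n) = (\<Pi>\<^sub>E i\<in>I. {..<n})"
  by (simp add: bernoulli_def space_PiM space_uniform_count_measure)

lemma sets_bernoulli: "sets (bernoulli I n) = sets (\<Pi>\<^sub>M i\<in>I. count_space {..<n})"
  unfolding bernoulli_def by (intro sets_PiM_cong) (auto simp: sets_uniform_count_measure)

lemma sets_bernoulli_finite:
  assumes "finite J"
  shows "sets (bernoulli J n) = Pow (\<Pi>\<^sub>E i\<in>J. {..<n})"
  using assms by (simp add: sets_bernoulli count_space_PiM_finite)

lemma measurable_bernoulli_component:
  assumes "i \<in> I"
  shows "(\<lambda>x. x i) \<in> bernoulli I n \<rightarrow>\<^sub>M count_space {..<n}"
proof -
  have "(\<lambda>x. x i) \<in> (\<Pi>\<^sub>M i\<in>I. count_space {..<n}) \<rightarrow>\<^sub>M count_space {..<n}"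
    using assms by (rule measurable_component_singleton)
  then show ?thesis
    by (simp add: measurable_cong_sets[OF sets_bernoulli refl])
qed

lemma measurable_to_bernoulli:
  assumes "\<And>i. i \<in> I \<Longrightarrow> (\<lambda>x. f x i) \<in> M \<rightarrow>\<^sub>M count_space {..<n}"
  shows "(\<lambda>x. \<lambda>i\<in>I. f x i) \<in> M \<rightarrow>\<^sub>M bernoulli I n"
proof -
  have "(\<lambda>x. \<lambda>i\<in>I. f x i) \<in> M \<rightarrow>\<^sub>M (\<Pi>\<^sub>M i\<in>I. count_space {..<n})"
    using assms by (rule measurable_restrict)
  then show ?thesis
    by (simp add: measurable_cong_sets[OF refl sets_bernoulli])
qed

lemma measurable_bernoulli_restrict:
  assumes "finite J" "J \<subseteq> I"
  shows "(\<lambda>x. restrict x J) \<in> bernoulli I n \<rightarrow>\<^sub>M count_space (\<Pi>\<^sub>E i\<in>J. {..<n})"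
proof -
  have "(\<lambda>x. restrict x J) \<in> bernoulli I n \<rightarrow>\<^sub>M bernoulli J n"
    using assms by (intro measurable_to_bernoulli measurable_bernoulli_component) auto
  moreover have "sets (bernoulli J n) = sets (count_space (\<Pi>\<^sub>E i\<in>J. {..<n}))"
    using assms by (simp add: sets_bernoulli_finite)
  ultimately show ?thesis
    using measurable_cong_sets by blast
qed

lemma prob_space_uniform:
  "n > 0 \<Longrightarrow> prob_space (uniform_count_measure {..<n::nat})"
  by (rule prob_space_uniform_count_measure) auto

lemma prob_space_bernoulli:
  assumes "n > 0" shows "prob_space (bernoulli I n)"
  unfolding bernoulli_def using assms by (intro prob_space_PiM prob_space_uniform)

lemma product_prob_space_uniform:
  assumes "n > 0" shows "product_prob_space (\<lambda>_::'i. uniform_count_measure {..<n::nat})"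
  using prob_space_uniform[OF assms]
  by (intro product_prob_spaceI) auto

text \<open>Integrals of functions of finitely many coordinates become averages over patterns
  through this law. Patterns carry the full power set as sigma-algebra, so arbitrary functions of a
  pattern can be integrated.\<close>

lemma bernoulli_restrict:
  assumes "n > 0" "finite J" "J \<subseteq> I"
  shows "distr (bernoulli I n) (count_space (\<Pi>\<^sub>E i\<in>J. {..<n})) (\<lambda>x. restrict x J)
    = uniform_count_measure (\<Pi>\<^sub>E i\<in>J. {..<n})" (is "?L = ?R")
proof (rule measure_eqI_finite)
  show "sets ?L = Pow (\<Pi>\<^sub>E i\<in>J. {..<n})" by simp
  show "sets ?R = Pow (\<Pi>\<^sub>E i\<in>J. {..<n})" by (simp add: sets_uniform_count_measure)
  show fin: "finite (\<Pi>\<^sub>E i\<in>J. {..<n})" using assms by (intro finite_PiE) auto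
  fix u assume u: "u \<in> (\<Pi>\<^sub>E i\<in>J. {..<n})"
  interpret product_prob_space "\<lambda>_::'a. uniform_count_measure {..<n}" I
    using product_prob_space_uniform assms(1) by blast
  have "emeasure ?L {u} = emeasure (bernoulli I n) {x\<in>space (bernoulli I n). \<forall>i\<in>J. x i \<in> {u i}}"
  proof -
    have "(\<lambda>x. restrict x J) -` {u} \<inter> space (bernoulli I n) = {x\<in>space (bernoulli I n). \<forall>i\<in>J. x i \<in> {u i}}"
      using u by (auto simp: PiE_iff extensional_def fun_eq_iff restrict_def)
    then show ?thesis
      using assms u by (subst emeasure_distr[OF measurable_bernoulli_restrict]) simp_all
  qed
  also have "\<dots> = (\<Prod>i\<in>J. emeasure (uniform_count_measure {..<n}) {u i})"
    unfolding bernoulli_def using assms u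
    by (intro emeasure_PiM_Collect) (auto simp: sets_uniform_count_measure PiE_iff)
  also have "\<dots> = (\<Prod>i\<in>J. ennreal (1 / real n))"
    using u assms by (intro prod.cong) (auto simp: emeasure_uniform_count_measure PiE_iff)
  also have "\<dots> = emeasure ?R {u}"
    using assms u fin
    by (simp add: emeasure_uniform_count_measure prod_ennreal card_PiE power_one_over ennreal_power)
  finally show "emeasure ?L {u} = emeasure ?R {u}" .
qed

text \<open>The coordinates are independent with equal laws, so an injective relabelling is not
  noticed. It serves twice: right multiplication gives invariance under the shift, a Cayley graph
  automorphism gives invariance under precomposition.\<close>

lemma bernoulli_reindex:
  assumes "n > 0" "inj_on f I" "f \<in> I \<rightarrow> I"
  shows "distr (bernoulli I n) (bernoulli I n) (\<lambda>x. \<lambda>i\<in>I. x (f i)) = bernoulli I n"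
  unfolding bernoulli_def
  by (rule distr_PiM_reindex[where M = "\<lambda>_. uniform_count_measure {..<n}"])
     (use assms prob_space_uniform in auto)

lemma integral_bernoulli_restrict:
  fixes h :: "('i \<Rightarrow> nat) \<Rightarrow> real"
  assumes "n > 0" "finite J" "J \<subseteq> I"
  shows "(\<integral>x. h (restrict x J) \<partial>bernoulli I n) = (\<Sum>u\<in>(\<Pi>\<^sub>E i\<in>J. {..<n}). h u) / real n ^ card J"
proof -
  have "finite (\<Pi>\<^sub>E i\<in>J. {..<n})" using assms by (intro finite_PiE) auto
  moreover have "(\<integral>x. h (restrict x J) \<partial>bernoulli I n)
    = (\<integral>u. h u \<partial>distr (bernoulli I n) (count_space (\<Pi>\<^sub>E i\<in>J. {..<n})) (\<lambda>x. restrict x J))"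
    using assms by (intro integral_distr[symmetric] measurable_bernoulli_restrict) auto
  ultimately show ?thesis
    using assms by (simp add: bernoulli_restrict integral_uniform_count_measure card_PiE)
qed

lemma measure_bernoulli_cylinder:
  assumes "n > 0" "finite J" "J \<subseteq> I" "u \<in> (\<Pi>\<^sub>E i\<in>J. {..<n})"
  shows "measure (bernoulli I n) {x \<in> space (bernoulli I n). restrict x J = u} = 1 / real n ^ card J"
proof -
  have "measure (bernoulli I n) {x \<in> space (bernoulli I n). restrict x J = u}
     = measure (distr (bernoulli I n) (count_space (\<Pi>\<^sub>E i\<in>J. {..<n})) (\<lambda>x. restrict x J)) {u}"
    using assms by (subst measure_distr[OF measurable_bernoulli_restrict])
      (auto intro!: arg_cong2[where f=measure])
  also have "\<dots> = 1 / real n ^ card J"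
    using assms by (simp add: bernoulli_restrict measure_uniform_count_measure card_PiE finite_PiE)
  finally show ?thesis .
qed

text \<open>Boxes over finite index sets determine the measure, and since the alphabet is finite a
  box is a finite disjoint union of cylinders.\<close>

lemma bernoulli_eqI:
  assumes n: "n > 0" and "prob_space M" and sets: "sets M = sets (bernoulli I n)"
    and cyl: "\<And>J u. finite J \<Longrightarrow> J \<subseteq> I \<Longrightarrow> u \<in> (\<Pi>\<^sub>E i\<in>J. {..<n}) \<Longrightarrow>
      measure M {x \<in> space M. restrict x J = u} = 1 / real n ^ card J"
  shows "M = bernoulli I n"
proof (rule measure_eqI_PiM_infinite)
  interpret prob_space M by fact
  interpret B: prob_space "bernoulli I n" using n by (rule prob_space_bernoulli)
  show "sets M = sets (\<Pi>\<^sub>M i\<in>I. uniform_count_measure {..<n})"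
    using sets by (simp add: bernoulli_def)
  show "sets (bernoulli I n) = sets (\<Pi>\<^sub>M i\<in>I. uniform_count_measure {..<n})"
    by (simp add: bernoulli_def)
  show "finite_measure M" by unfold_locales
  fix A J assume J: "finite J" "J \<subseteq> I" and A: "\<And>i. i \<in> J \<Longrightarrow> A i \<in> sets (uniform_count_measure {..<n})"
  have A': "A i \<subseteq> {..<n}" if "i \<in> J" for i
    using A[OF that] by (auto simp: sets_uniform_count_measure)
  have sp: "space M = space (bernoulli I n)" using sets by (rule sets_eq_imp_space_eq)
  let ?E = "prod_emb I (\<lambda>_. uniform_count_measure {..<n}) J (Pi\<^sub>E J A)"
  have fin: "finite (Pi\<^sub>E J A)"
    using J A' by (intro finite_PiE) (auto intro: finite_subset)
  have E: "?E = (\<Union>u\<in>Pi\<^sub>E J A. {x \<in> space M. restrict x J = u})"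
    by (auto simp: prod_emb_def sp space_bernoulli space_uniform_count_measure)
  have cylset: "{x \<in> space M. restrict x J = u} \<in> sets M" for u
  proof (cases "u \<in> (\<Pi>\<^sub>E i\<in>J. {..<n})")
    case True
    have "(\<lambda>x. restrict x J) -` {u} \<inter> space (bernoulli I n) \<in> sets (bernoulli I n)"
      using J True by (intro measurable_sets[OF measurable_bernoulli_restrict]) auto
    moreover have "(\<lambda>x. restrict x J) -` {u} \<inter> space (bernoulli I n) = {x \<in> space M. restrict x J = u}"
      by (auto simp: sp)
    ultimately show ?thesis by (simp add: sets)
  next
    case False
    then have "{x \<in> space M. restrict x J = u} = {}"
      using J by (auto simp: sp space_bernoulli)
    then show ?thesis by (simp only: sets.empty_sets)
  qed
  have disj: "disjoint_family_on (\<lambda>u. {x \<in> space M. restrict x J = u}) (Pi\<^sub>E J A)"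
    by (auto simp: disjoint_family_on_def)
  have uA: "u \<in> (\<Pi>\<^sub>E i\<in>J. {..<n})" if "u \<in> Pi\<^sub>E J A" for u
    using that A' by (auto simp: PiE_iff)
  have "measure M ?E = (\<Sum>u\<in>Pi\<^sub>E J A. measure M {x \<in> space M. restrict x J = u})"
    unfolding E using fin cylset disj by (intro finite_measure_finite_Union) auto
  also have "\<dots> = (\<Sum>u\<in>Pi\<^sub>E J A. measure (bernoulli I n) {x \<in> space M. restrict x J = u})"
    by (intro sum.cong refl)
      (simp only: sp cyl[OF J uA, unfolded sp] measure_bernoulli_cylinder[OF n J uA])
  also have "\<dots> = measure (bernoulli I n) ?E"
    unfolding E using fin cylset disj sets
    by (intro B.finite_measure_finite_Union[symmetric]) auto
  finally show "emeasure M ?E = emeasure (bernoulli I n) ?E"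
    by (simp add: emeasure_eq_measure B.emeasure_eq_measure)
qed

text \<open>Functions reading disjoint windows are independent: the coordinates are independent
  because their joint law is the product of the marginals, and disjoint blocks of independent
  variables are again independent.\<close>

lemma integral_bernoulli_prod:
  fixes q :: "'j \<Rightarrow> ('i \<Rightarrow> nat) \<Rightarrow> real"
  assumes n: "n > 0" and J: "finite J" and B: "\<And>j. j \<in> J \<Longrightarrow> finite (B j)" "\<And>j. j \<in> J \<Longrightarrow> B j \<subseteq> I"
    and disj: "disjoint_family_on B J" and "I \<noteq> {}"
  shows "(\<integral>x. (\<Prod>j\<in>J. q j (restrict x (B j))) \<partial>bernoulli I n)
    = (\<Prod>j\<in>J. \<integral>x. q j (restrict x (B j)) \<partial>bernoulli I n)"
proof -
  interpret prob_space "bernoulli I n" using n by (rule prob_space_bernoulli)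
  interpret U: product_prob_space "\<lambda>_::'i. uniform_count_measure {..<n}" I
    using product_prob_space_uniform n by blast
  let ?U = "uniform_count_measure {..<n}"
  have ind: "indep_vars (\<lambda>_. ?U) (\<lambda>i x. x i) I"
  proof (subst indep_vars_iff_distr_eq_PiM')
    show "I \<noteq> {}" by fact
    show "(\<lambda>x. x i) \<in> bernoulli I n \<rightarrow>\<^sub>M ?U" if "i \<in> I" for i
      using that unfolding bernoulli_def by (intro measurable_component_singleton)
    have "distr (bernoulli I n) (Pi\<^sub>M I (\<lambda>_. ?U)) (\<lambda>x. restrict x I) = bernoulli I n"
      unfolding bernoulli_def
      by (rule distr_PiM_reindex[where M = "\<lambda>_. ?U" and f = "\<lambda>i. i"]) (use n prob_space_uniform in auto)
    moreover have "distr (bernoulli I n) ?U (\<lambda>x. x i) = ?U" if "i \<in> I" for i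
      unfolding bernoulli_def using U.PiM_component[OF that] by simp
    ultimately show "distr (bernoulli I n) (Pi\<^sub>M I (\<lambda>_. ?U)) (\<lambda>x. \<lambda>i\<in>I. x i)
      = (\<Pi>\<^sub>M i\<in>I. distr (bernoulli I n) ?U (\<lambda>x. x i))"
      by (simp add: bernoulli_def cong: PiM_cong)
  qed
  have "indep_vars (\<lambda>j. PiM (B j) (\<lambda>_. ?U)) (\<lambda>j x. restrict x (B j)) J"
    using indep_vars_restrict[OF ind B(2) disj] by simp
  then have ind2: "indep_vars (\<lambda>_. borel) (\<lambda>j x. q j (restrict x (B j))) J"
  proof (rule indep_vars_compose2)
    fix j assume "j \<in> J"
    then have eq: "sets (PiM (B j) (\<lambda>_. ?U)) = sets (count_space (\<Pi>\<^sub>E i\<in>B j. {..<n}))"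
      using sets_bernoulli_finite[OF B(1), of j n] by (simp add: bernoulli_def)
    show "q j \<in> borel_measurable (PiM (B j) (\<lambda>_. ?U))"
      unfolding measurable_cong_sets[OF eq refl] by simp
  qed
  have "integrable (bernoulli I n) (\<lambda>x. q j (restrict x (B j)))" if "j \<in> J" for j
    using that B
    by (intro integrable_compose_count_space[OF _ measurable_bernoulli_restrict] finite_PiE) auto
  then show ?thesis by (intro indep_vars_lebesgue_integral J ind2)
qed

section \<open>Finite-window inverses of injective measurable maps\<close>

text \<open>Enumerating the countable index set places configurations in the Polish space
  \<^typ>\<open>nat \<Rightarrow> real\<close>; real rather than natural coordinates are used because \<^typ>\<open>nat\<close> is not
  an instance of \<^class>\<open>metric_space\<close>. Reducing modulo \<open>n\<close> makes the left inverse total.\<close>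

definition to_seq :: "'i set \<Rightarrow> ('i \<Rightarrow> nat) \<Rightarrow> nat \<Rightarrow> real" where
  "to_seq I x = (\<lambda>k. real (x (from_nat_into I k)))"

definition of_seq :: "'i set \<Rightarrow> nat \<Rightarrow> (nat \<Rightarrow> real) \<Rightarrow> 'i \<Rightarrow> nat" where
  "of_seq I n p = (\<lambda>i\<in>I. nat \<lfloor>p (to_nat_on I i)\<rfloor> mod n)"

lemma of_seq_to_seq:
  assumes "countable I" "x \<in> space (bernoulli I n)"
  shows "of_seq I n (to_seq I x) = x"
  using assms by (fastforce simp: of_seq_def to_seq_def space_bernoulli PiE_iff extensional_def)

lemma measurable_to_seq:
  assumes "I \<noteq> {}"
  shows "to_seq I \<in> bernoulli I n \<rightarrow>\<^sub>M borel"
proof (rule measurable_coordinatewise_then_product)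
  fix k
  have "(\<lambda>x. x (from_nat_into I k)) \<in> bernoulli I n \<rightarrow>\<^sub>M count_space {..<n}"
    using assms by (intro measurable_bernoulli_component from_nat_into)
  then show "(\<lambda>x. to_seq I x k) \<in> borel_measurable (bernoulli I n)"
    unfolding to_seq_def by (rule measurable_compose) simp
qed

lemma measurable_of_seq:
  assumes "n > 0"
  shows "of_seq I n \<in> borel \<rightarrow>\<^sub>M bernoulli I n"
  unfolding of_seq_def
proof (rule measurable_to_bernoulli)
  fix i
  have "(\<lambda>p :: nat \<Rightarrow> real. p (to_nat_on I i)) \<in> borel \<rightarrow>\<^sub>M borel"
    by (rule measurable_product_coordinates)
  then have "(\<lambda>p :: nat \<Rightarrow> real. \<lfloor>p (to_nat_on I i)\<rfloor>) \<in> borel \<rightarrow>\<^sub>M count_space UNIV"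
    by measurable
  then show "(\<lambda>p :: nat \<Rightarrow> real. nat \<lfloor>p (to_nat_on I i)\<rfloor> mod n) \<in> borel \<rightarrow>\<^sub>M count_space {..<n}"
    by (rule measurable_compose) (use assms in auto)
qed

text \<open>Inner regularity is applied to the joint distribution of \<open>x\<close> and \<open>f x\<close>, so that a single
  compact set makes \<open>f\<close> continuous on a large set and its image measurable, without the
  Lusin-Souslin theorem.\<close>

lemma compact_subgraph:
  assumes n: "n > 0" and I: "countable I" "I \<noteq> {}"
    and D: "D \<in> sets (bernoulli I n)" "measure (bernoulli I n) D = 1"
    and f: "f \<in> bernoulli I n \<rightarrow>\<^sub>M bernoulli I n" and "e > 0"
  obtains K where "compact K" "K \<subseteq> (\<lambda>x. (to_seq I x, to_seq I (f x))) ` D"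
    "measure (bernoulli I n) {x \<in> space (bernoulli I n). (to_seq I x, to_seq I (f x)) \<in> K} > 1 - e"
proof -
  let ?B = "bernoulli I n"
  interpret prob_space ?B using n by (rule prob_space_bernoulli)
  define h where "h x = (to_seq I x, to_seq I (f x))" for x
  note [measurable] = measurable_to_seq[OF I(2)] measurable_of_seq[OF n] f D(1)
  have h [measurable]: "h \<in> borel_measurable ?B" unfolding h_def by measurable
  let ?d = "of_seq I n"
  \<comment> \<open>The graph of \<open>f\<close> over \<open>D\<close>, written without a
    quantifier: decode the first component, require that it was a genuine code, and compare the
    second. Each condition involves only Borel maps, so the set is visibly Borel.\<close>
  let ?G = "{w. ?d (fst w) \<in> D \<and> to_seq I (?d (fst w)) = fst w \<and> snd w = to_seq I (f (?d (fst w)))}"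
  have D': "x \<in> space ?B" if "x \<in> D" for x
    using that sets.sets_into_space[OF D(1)] by auto
  have hD: "h ` D = ?G"
  proof (intro equalityI subsetI)
    fix w assume "w \<in> h ` D" then show "w \<in> ?G"
      using of_seq_to_seq[OF I(1) D'] by (auto simp: h_def)
  next
    fix w assume "w \<in> ?G"
    then have "w = h (?d (fst w))" "?d (fst w) \<in> D" by (auto simp: h_def prod_eq_iff)
    then show "w \<in> h ` D" by blast
  qed
  have "{w \<in> space borel. ?d (fst w) \<in> D \<and> to_seq I (?d (fst w)) = fst w \<and> snd w = to_seq I (f (?d (fst w)))} \<in> sets borel"
  proof (intro sets.sets_Collect_conj)
    let ?P = "borel :: ((nat \<Rightarrow> real) \<times> (nat \<Rightarrow> real)) measure"
    have fst: "fst \<in> borel_measurable ?P" and snd: "snd \<in> borel_measurable ?P"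
      by (intro borel_measurable_continuous_onI continuous_on_fst continuous_on_snd continuous_on_id)+
    have d1: "(\<lambda>w. ?d (fst w)) \<in> ?P \<rightarrow>\<^sub>M ?B"
      by (rule measurable_compose[OF fst measurable_of_seq[OF n]])
    show "{w \<in> space ?P. ?d (fst w) \<in> D} \<in> sets borel"
      using measurable_sets[OF d1 D(1)] by (simp add: vimage_def Int_def conj_commute)
    show "{w \<in> space ?P. to_seq I (?d (fst w)) = fst w} \<in> sets borel"
      by (intro measurable_equality_set fst measurable_compose[OF d1 measurable_to_seq[OF I(2)]])
    show "{w \<in> space ?P. snd w = to_seq I (f (?d (fst w)))} \<in> sets borel"
      by (intro measurable_equality_set snd measurable_compose[OF measurable_compose[OF d1 f] measurable_to_seq[OF I(2)]])
  qed
  then have G: "?G \<in> sets borel" by simp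
  let ?R = "distr ?B borel h"
  interpret R: prob_space ?R by (rule prob_space_distr) (rule h)
  have "emeasure ?B D \<le> emeasure ?R ?G"
    unfolding emeasure_distr[OF h G] using hD D'
    by (intro emeasure_mono measurable_sets[OF h G]) auto
  then have G1: "1 \<le> emeasure ?R ?G" using D(2) by (simp add: emeasure_eq_measure)
  have "ennreal (1 - e) < 1" using \<open>e > 0\<close> by (cases "1 - e \<ge> 0") (auto simp: ennreal_neg)
  also note G1
  also have "emeasure ?R ?G = (SUP K \<in> {K. K \<subseteq> ?G \<and> compact K}. emeasure ?R K)"
    by (rule inner_regular[OF _ _ G]) (simp_all add: R.emeasure_eq_measure)
  finally have "ennreal (1 - e) < (SUP K \<in> {K. K \<subseteq> ?G \<and> compact K}. emeasure ?R K)" .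
  then obtain K where K: "K \<subseteq> ?G" "compact K" "ennreal (1 - e) < emeasure ?R K"
    unfolding less_SUP_iff by auto
  have "emeasure ?R K = emeasure ?B {x \<in> space ?B. h x \<in> K}"
    using K(2) by (subst emeasure_distr[OF h])
      (auto intro!: borel_compact arg_cong2[where f = emeasure])
  then have "1 - e < measure ?B {x \<in> space ?B. h x \<in> K}"
    using K(3) by (simp add: emeasure_eq_measure ennreal_less_iff not_less[symmetric])
      (meson ennreal_leI not_less)
  then show thesis using that K hD by (simp add: h_def)
qed

text \<open>Disjoint compact sets lie at positive distance, while points that agree on the first
  coordinates are at distance at most \<open>(1/2) ^ N\<close>. The metric orders coordinates by the
  enumeration \<open>from_nat\<close> of the index type, which is why the separating set is an image
  under it.\<close>

lemma compact_separating_coordinates: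
  fixes A B :: "(nat \<Rightarrow> real) set"
  assumes "compact A" "compact B" "A \<inter> B = {}"
  obtains Z where "finite Z" "\<And>p q. p \<in> A \<Longrightarrow> q \<in> B \<Longrightarrow> \<exists>z\<in>Z. p z \<noteq> q z"
proof -
  obtain d where d: "d > 0" "\<forall>p\<in>A. \<forall>q\<in>B. d \<le> dist p q"
  proof (cases "A \<times> B = {}")
    case True
    then show thesis by (intro that[of 1]) auto
  next
    case False
    then obtain w where w: "w \<in> A \<times> B" "\<forall>v\<in>A \<times> B. dist (fst w) (snd w) \<le> dist (fst v) (snd v)"
      using continuous_attains_inf[OF compact_Times[OF assms(1,2)] False
          continuous_on_dist[OF continuous_on_fst[OF continuous_on_id] continuous_on_snd[OF continuous_on_id]]]
      by blast
    then show thesis using assms(3) by (intro that[of "dist (fst w) (snd w)"]) fastforce+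
  qed
  obtain N where N: "(1/2 :: real) ^ N < d"
    using real_arch_pow_inv[OF d(1), of "1/2"] by auto
  show thesis
  proof (rule that)
    show "finite ((from_nat :: nat \<Rightarrow> nat) ` {..N})" by simp
    fix p q assume pq: "p \<in> A" "q \<in> B"
    show "\<exists>z\<in>from_nat ` {..N}. p z \<noteq> q z"
    proof (rule ccontr)
      assume "\<not> ?thesis"
      then have "{dist (p (from_nat m)) (q (from_nat m)) |m. m \<le> N} = {0}"
        by (auto intro!: exI[of _ 0])
      then have "dist p q \<le> (1/2) ^ N"
        using dist_fun_le_dist_first_terms[of p q N] by simp
      then show False using N d pq by fastforce
    qed
  qed
qed

lemma inj_to_seq:
  assumes "countable I" "x \<in> space (bernoulli I n)" "y \<in> space (bernoulli I n)" "to_seq I x = to_seq I y"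
  shows "x = y"
  using assms of_seq_to_seq by metis

text \<open>Over a large compact part of the graph of \<open>f\<close>, the images of points with a
  given symbol at \<open>i\<close> form a compact set, and injectivity makes these sets disjoint for
  different symbols. With finitely many symbols there are finitely many pairs to separate, each by
  finitely many coordinates.\<close>

lemma finite_window_decoder:
  assumes n: "n > 0" and I: "countable I" "i \<in> I"
    and D: "D \<in> sets (bernoulli I n)" "measure (bernoulli I n) D = 1"
    and f: "f \<in> bernoulli I n \<rightarrow>\<^sub>M bernoulli I n" and inj: "inj_on f D" and e: "e > 0"
  obtains W \<phi> where "finite W" "W \<subseteq> I"
    "measure (bernoulli I n) {x \<in> space (bernoulli I n). \<phi> (restrict (f x) W) \<noteq> x i} < e"
proof -
  let ?B = "bernoulli I n"
  interpret prob_space ?B using n by (rule prob_space_bernoulli)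
  have ne: "I \<noteq> {}" using I by auto
  obtain K where K: "compact K" "K \<subseteq> (\<lambda>x. (to_seq I x, to_seq I (f x))) ` D"
    "prob {x \<in> space ?B. (to_seq I x, to_seq I (f x)) \<in> K} > 1 - e"
    using compact_subgraph[OF n I(1) ne D f e] .
  have D': "x \<in> space ?B" if "x \<in> D" for x
    using that sets.sets_into_space[OF D(1)] by auto
  have fD: "f x \<in> space ?B" if "x \<in> space ?B" for x
    using that measurable_space[OF f] by auto
  define k where "k = to_nat_on I i"
  have k: "to_seq I x k = real (x i)" for x
    using I by (simp add: to_seq_def k_def)
  define L where "L a = snd ` (K \<inter> {w. fst w k = real a})" for a
  have compL: "compact (L a)" for a
  proof -
    have "closed {w :: (nat \<Rightarrow> real) \<times> (nat \<Rightarrow> real). fst w k = real a}"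
      by (intro closed_Collect_eq continuous_on_const
          continuous_on_compose2[OF continuous_on_product_coordinates[of k] continuous_on_fst[OF continuous_on_id]]) auto
    then show ?thesis unfolding L_def using K(1)
      by (intro compact_continuous_image compact_Int_closed continuous_intros)
  qed
  have disjL: "a = b" if ab: "q \<in> L a" "q \<in> L b" for a b q
  proof -
    obtain x y where "x \<in> D" "y \<in> D" "x i = a" "y i = b" "q = to_seq I (f x)" "q = to_seq I (f y)"
    proof -
      from ab(1) obtain w where w: "w \<in> K" "fst w k = real a" "q = snd w" unfolding L_def by blast
      from ab(2) obtain v where v: "v \<in> K" "fst v k = real b" "q = snd v" unfolding L_def by blast
      from w v K(2) obtain x y where "x \<in> D" "y \<in> D" "w = (to_seq I x, to_seq I (f x))"
        "v = (to_seq I y, to_seq I (f y))" by blast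
      with w v show thesis by (intro that[of x y]) (auto simp: k)
    qed
    then show ?thesis using inj_to_seq[OF I(1) fD fD] D' inj by (metis inj_onD)
  qed
  have "\<exists>Z. finite Z \<and> (a \<noteq> b \<longrightarrow> (\<forall>p\<in>L a. \<forall>q\<in>L b. \<exists>z\<in>Z. p z \<noteq> q z))" for a b
  proof (cases "a = b")
    case False
    then have "L a \<inter> L b = {}" using disjL by auto
    then show ?thesis
      using compact_separating_coordinates[OF compL compL] by metis
  qed auto
  then obtain Z where Z: "\<And>a b. finite (Z a b)"
      "\<And>a b p q. a \<noteq> b \<Longrightarrow> p \<in> L a \<Longrightarrow> q \<in> L b \<Longrightarrow> \<exists>z\<in>Z a b. p z \<noteq> q z"
    by metis
  define Z' where "Z' = (\<Union>a<n. \<Union>b<n. Z a b)"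
  define W where "W = from_nat_into I ` Z'"
  \<comment> \<open>A symbol is compatible with a window if some point of \<open>L a\<close> agrees
    with it there. Over the compact set the true symbol is compatible and no other one is; elsewhere
    \<open>SOME\<close> may return anything, even a value not below \<open>n\<close>.\<close>
  define P where "P y a \<longleftrightarrow> a < n \<and> (\<exists>q\<in>L a. \<forall>z\<in>Z'. q z = real (y (from_nat_into I z)))"
    for y :: "'a \<Rightarrow> nat" and a
  define \<phi> where "\<phi> y = (SOME a. P y a)" for y
  have fin: "finite W" using Z by (auto simp: W_def Z'_def)
  have W: "W \<subseteq> I" using ne by (auto simp: W_def intro: from_nat_into)
  have dec: "\<phi> (restrict (f x) W) = x i"
    if x: "x \<in> space ?B" "(to_seq I x, to_seq I (f x)) \<in> K" for x
  proof -
    let ?y = "restrict (f x) W"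
    have L: "to_seq I (f x) \<in> L (x i)" using x k by (force simp: L_def)
    have xi: "x i < n" using x I by (auto simp: space_bernoulli PiE_iff)
    have agree: "real (?y (from_nat_into I z)) = to_seq I (f x) z" if "z \<in> Z'" for z
      using that by (auto simp: W_def to_seq_def)
    then have "P ?y (x i)" unfolding P_def using L xi by auto
    then have "P ?y (\<phi> ?y)" unfolding \<phi>_def by (rule someI)
    then obtain q where q: "\<phi> ?y < n" "q \<in> L (\<phi> ?y)" "\<forall>z\<in>Z'. q z = to_seq I (f x) z"
      unfolding P_def using agree by auto
    show ?thesis
    proof (rule ccontr)
      assume "\<phi> ?y \<noteq> x i"
      from Z(2)[OF this q(2) L] obtain z where "z \<in> Z (\<phi> ?y) (x i)" "q z \<noteq> to_seq I (f x) z" by blast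
      then show False using q(1,3) xi by (auto simp: Z'_def)
    qed
  qed
  have "(\<lambda>x. (to_seq I x, to_seq I (f x))) \<in> borel_measurable ?B"
    using f measurable_to_seq[OF ne] by measurable
  from measurable_sets[OF this borel_compact[OF K(1)]]
  have ev: "{x \<in> space ?B. (to_seq I x, to_seq I (f x)) \<in> K} \<in> events"
    by (simp add: vimage_def Int_def conj_commute)
  have "prob {x \<in> space ?B. \<phi> (restrict (f x) W) \<noteq> x i}
      \<le> prob (space ?B - {x \<in> space ?B. (to_seq I x, to_seq I (f x)) \<in> K})"
    using dec ev by (intro finite_measure_mono) auto
  also have "\<dots> < e" using K(3) ev by (simp add: prob_compl)
  finally show thesis using that fin W by blast
qed

section \<open>Injective equivariant maps over amenable groups\<close>

text \<open>A substitute for entropy: \<open>u \<mapsto> \<Sum>v. R v * T u v\<close> is a subprobability on the patterns over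
  \<open>F\<close>, and a uniformly distributed pattern has expected code length at least \<open>|F| ln n\<close> under it,
  by \<open>ln y \<le> y - 1\<close>.\<close>

lemma coding_inequality:
  fixes R :: "'v \<Rightarrow> real" and T :: "('i \<Rightarrow> nat) \<Rightarrow> 'v \<Rightarrow> real"
  assumes n: "n > 0" and F: "finite F" "F \<subseteq> I"
    and A: "finite A" "V \<in> bernoulli I n \<rightarrow>\<^sub>M count_space A"
    and R: "\<And>v. v \<in> A \<Longrightarrow> R v > 0" "(\<Sum>v\<in>A. R v) \<le> 1"
    and T: "\<And>u v. u \<in> (\<Pi>\<^sub>E i\<in>F. {..<n}) \<Longrightarrow> v \<in> A \<Longrightarrow> T u v > 0"
      "\<And>v. v \<in> A \<Longrightarrow> (\<Sum>u\<in>(\<Pi>\<^sub>E i\<in>F. {..<n}). T u v) \<le> 1"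
  shows "(\<integral>x. ln (R (V x)) + ln (T (restrict x F) (V x)) \<partial>bernoulli I n) \<le> - (real (card F) * ln (real n))"
proof -
  let ?B = "bernoulli I n" and ?P = "\<Pi>\<^sub>E i\<in>F. {..<n}"
  interpret prob_space ?B using n by (rule prob_space_bernoulli)
  have finP: "finite ?P" using F by (intro finite_PiE) auto
  note rF = measurable_bernoulli_restrict[OF F]
  note int = integrable_compose_count_space2[OF finP A(1) rF A(2)]
  let ?c = "real n ^ card F"
  have c: "?c > 0" using n by simp
  have VA: "V x \<in> A" and rP: "restrict x F \<in> ?P" if "x \<in> space ?B" for x
    using measurable_space[OF A(2) that] measurable_space[OF rF that] by auto
  \<comment> \<open>Here \<open>?c\<close> is the number of patterns over \<open>F\<close>.
    Enlarging the single term at \<open>V x\<close> to the sum over all \<open>v\<close> leaves a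
    function of \<open>restrict x F\<close> alone, whose mean is an average over patterns.\<close>
  have le: "ln (R (V x)) + ln (T (restrict x F) (V x))
      \<le> ?c * (\<Sum>v\<in>A. R v * T (restrict x F) v) - 1 - ln ?c" if x: "x \<in> space ?B" for x
  proof -
    have pos: "R (V x) > 0" "T (restrict x F) (V x) > 0"
      using R(1) T(1) VA rP x by auto
    have "ln (?c * (R (V x) * T (restrict x F) (V x))) \<le> ?c * (R (V x) * T (restrict x F) (V x)) - 1"
      using pos c by (intro ln_le_minus_one) simp
    also have "R (V x) * T (restrict x F) (V x) \<le> (\<Sum>v\<in>A. R v * T (restrict x F) v)"
      using R(1) T(1)[OF rP[OF x]] VA[OF x] A(1)
      by (intro member_le_sum[of "V x" A "\<lambda>v. R v * T (restrict x F) v"]) (auto intro: less_imp_le)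
    finally show ?thesis using pos c by (simp add: ln_mult)
  qed
  have "(\<integral>x. ln (R (V x)) + ln (T (restrict x F) (V x)) \<partial>?B)
      \<le> (\<integral>x. ?c * (\<Sum>v\<in>A. R v * T (restrict x F) v) - 1 - ln ?c \<partial>?B)"
  proof (rule integral_mono)
    show "integrable ?B (\<lambda>x. ln (R (V x)) + ln (T (restrict x F) (V x)))"
      by (rule int[of "\<lambda>u v. ln (R v) + ln (T u v)"])
    show "integrable ?B (\<lambda>x. ?c * (\<Sum>v\<in>A. R v * T (restrict x F) v) - 1 - ln ?c)"
      by (rule int[of "\<lambda>u _. ?c * (\<Sum>v\<in>A. R v * T u v) - 1 - ln ?c"])
  qed (rule le)
  also have "\<dots> = (\<Sum>u\<in>?P. ?c * (\<Sum>v\<in>A. R v * T u v) - 1 - ln ?c) / ?c"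
    using integral_bernoulli_restrict[OF n F, of "\<lambda>u. ?c * (\<Sum>v\<in>A. R v * T u v) - 1 - ln ?c"] .
  also have "\<dots> = (\<Sum>u\<in>?P. \<Sum>v\<in>A. R v * T u v) - 1 - ln ?c"
    using c F by (simp add: sum_subtractf card_PiE sum_distrib_left[symmetric] field_simps)
  finally have "(\<integral>x. ln (R (V x)) + ln (T (restrict x F) (V x)) \<partial>?B)
      \<le> (\<Sum>u\<in>?P. \<Sum>v\<in>A. R v * T u v) - 1 - ln ?c" .
  moreover have "(\<Sum>u\<in>?P. \<Sum>v\<in>A. R v * T u v) = (\<Sum>v\<in>A. R v * (\<Sum>u\<in>?P. T u v))"
    by (subst sum.swap) (simp add: sum_distrib_left)
  moreover have "\<dots> \<le> (\<Sum>v\<in>A. R v * 1)"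
    using R(1) T(2) by (intro sum_mono mult_left_mono) (auto intro: less_imp_le)
  ultimately show ?thesis using R(2) ln_realpow[of "real n" "card F"] n by simp
qed

section \<open>Folner sets, packings by translates, and shift invariance\<close>

context group
begin

text \<open>The finitely many Folner ratios add up to one sequence tending to 0, and each translate
  uF lies in the union of F and its symmetric difference with uF.\<close>

lemma folner_set:
  assumes "amenable_group G" "finite U" "U \<subseteq> carrier G" "e > 0"
  obtains F where "F \<subseteq> carrier G" "finite F" "F \<noteq> {}"
    "real (card (\<Union>u\<in>U. u <#\<^bsub>G\<^esub> F)) \<le> (1 + e) * real (card F)"
proof -
  obtain F where F: "\<And>m. F m \<subseteq> carrier G" "\<And>m. finite (F m)" "\<And>m. F m \<noteq> {}"
    and lim: "\<And>g. g \<in> carrier G \<Longrightarrow>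
      (\<lambda>m. real (card (sym_diff (g <#\<^bsub>G\<^esub> F m) (F m))) / real (card (F m))) \<longlonglongrightarrow> 0"
    using assms(1) unfolding amenable_group_def by blast
  have "(\<lambda>m. \<Sum>g\<in>U. real (card (sym_diff (g <#\<^bsub>G\<^esub> F m) (F m))) / real (card (F m))) \<longlonglongrightarrow> (\<Sum>g\<in>U. 0)"
    using assms(3) by (intro tendsto_sum lim) auto
  then have "\<forall>\<^sub>F m in sequentially. (\<Sum>g\<in>U. real (card (sym_diff (g <#\<^bsub>G\<^esub> F m) (F m))) / real (card (F m))) < e"
    using assms(4) by (intro order_tendstoD) auto
  then obtain m where m: "(\<Sum>g\<in>U. real (card (sym_diff (g <#\<^bsub>G\<^esub> F m) (F m))) / real (card (F m))) < e"
    by (auto simp: eventually_sequentially)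
  have pos: "card (F m) > 0" using F by (simp add: card_gt_0_iff)
  have fin: "finite (sym_diff (g <#\<^bsub>G\<^esub> F m) (F m))" for g
    using F(2)[of m] by (auto simp: l_coset_def)
  have "(\<Union>u\<in>U. u <#\<^bsub>G\<^esub> F m) \<subseteq> F m \<union> (\<Union>g\<in>U. sym_diff (g <#\<^bsub>G\<^esub> F m) (F m))" by auto
  then have "card (\<Union>u\<in>U. u <#\<^bsub>G\<^esub> F m) \<le> card (F m \<union> (\<Union>g\<in>U. sym_diff (g <#\<^bsub>G\<^esub> F m) (F m)))"
    using fin F(2) assms(2) by (intro card_mono) blast+
  also have "\<dots> \<le> card (F m) + (\<Sum>g\<in>U. card (sym_diff (g <#\<^bsub>G\<^esub> F m) (F m)))"
    by (intro order.trans[OF card_Un_le] add_left_mono card_UN_le assms)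
  finally have "real (card (\<Union>u\<in>U. u <#\<^bsub>G\<^esub> F m)) \<le> card (F m) + (\<Sum>g\<in>U. real (card (sym_diff (g <#\<^bsub>G\<^esub> F m) (F m))))"
    unfolding of_nat_sum[symmetric] of_nat_add[symmetric] of_nat_le_iff .
  also have "\<dots> \<le> card (F m) + e * card (F m)"
    using m pos by (simp add: sum_divide_distrib[symmetric] divide_less_eq)
  finally show thesis using F by (intro that[of "F m"]) (auto simp: algebra_simps)
qed

text \<open>Take a maximal disjoint subfamily: for every \<open>g\<close> in \<open>F\<close> the
  translate Eg meets some Ej, which puts \<open>g\<close> into E^-1 E j, a set of at most |E|^2
  elements. Right translates occur because \<open>shift G g x\<close> reads at \<open>h\<close> the
  coordinate \<open>h \<otimes> g\<close> of \<open>x\<close>.\<close>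

lemma disjoint_translates:
  assumes E: "finite E" "E \<subseteq> carrier G" "E \<noteq> {}" and F: "finite F" "F \<subseteq> carrier G"
  obtains J where "J \<subseteq> F" "disjoint_family_on (\<lambda>g. E #> g) J" "card F \<le> (card E)\<^sup>2 * card J"
proof -
  let ?S = "{J. J \<subseteq> F \<and> disjoint_family_on (\<lambda>g. E #> g) J}"
  have fin: "finite ?S" using F by simp
  have "{} \<in> ?S" by (simp add: disjoint_family_on_def)
  from finite_has_maximal2[OF fin this] obtain J
    where J: "J \<in> ?S" "\<forall>J'\<in>?S. J \<subseteq> J' \<longrightarrow> J = J'" by (elim bexE conjE)
  have "F \<subseteq> (\<Union>j\<in>J. (\<lambda>(d, d'). inv d \<otimes> d' \<otimes> j) ` (E \<times> E))"
  proof
    fix g assume g: "g \<in> F"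
    have "\<exists>j\<in>J. (E #> g) \<inter> (E #> j) \<noteq> {}"
    proof (cases "g \<in> J")
      case True
      then show ?thesis using E(3) by (auto simp: r_coset_def)
    next
      case False
      show ?thesis
      proof (rule ccontr)
        assume "\<not> ?thesis"
        then have "insert g J \<in> ?S"
          using J(1) g unfolding disjoint_family_on_def by blast
        with J(2) have "J = insert g J" by (meson subset_insertI)
        with False show False by blast
      qed
    qed
    then obtain j d d' where jd: "j \<in> J" "d \<in> E" "d' \<in> E" "d \<otimes> g = d' \<otimes> j"
      by (auto simp: r_coset_def)
    moreover have "d \<in> carrier G" "d' \<in> carrier G" "g \<in> carrier G" "j \<in> carrier G"
      using jd E F J(1) g by auto
    ultimately have "g = inv d \<otimes> d' \<otimes> j" by (simp add: inv_solve_left m_assoc)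
    then show "g \<in> (\<Union>j\<in>J. (\<lambda>(d, d'). inv d \<otimes> d' \<otimes> j) ` (E \<times> E))" using jd by force
  qed
  moreover have finJ: "finite J" using J(1) F finite_subset by auto
  ultimately have "card F \<le> card (\<Union>j\<in>J. (\<lambda>(d, d'). inv d \<otimes> d' \<otimes> j) ` (E \<times> E))"
    using E(1) by (intro card_mono) auto
  also have "\<dots> \<le> (\<Sum>j\<in>J. card ((\<lambda>(d, d'). inv d \<otimes> d' \<otimes> j) ` (E \<times> E)))"
    using finJ by (rule card_UN_le)
  also have "\<dots> \<le> (\<Sum>j\<in>J. card (E \<times> E))"
    using E(1) by (intro sum_mono card_image_le) auto
  also have "\<dots> = (card E)\<^sup>2 * card J" by (simp add: card_cartesian_product power2_eq_square)
  finally show thesis using that J(1) by blast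
qed

lemma shift_apply: "h \<in> carrier G \<Longrightarrow> shift G g x h = x (h \<otimes> g)"
  by (simp add: shift_def)

lemma distr_shift:
  assumes "n > 0" "g \<in> carrier G"
  shows "distr (bernoulli (carrier G) n) (bernoulli (carrier G) n) (shift G g) = bernoulli (carrier G) n"
  using bernoulli_reindex[OF assms(1), of "\<lambda>h. h \<otimes> g" "carrier G"] assms(2)
  by (simp add: shift_def[abs_def] inj_on_def)

lemma measurable_shift:
  assumes "g \<in> carrier G"
  shows "shift G g \<in> bernoulli (carrier G) n \<rightarrow>\<^sub>M bernoulli (carrier G) n"
  unfolding shift_def[abs_def] using assms
  by (intro measurable_to_bernoulli measurable_bernoulli_component) auto

lemma integral_shift:
  fixes h :: "('a \<Rightarrow> nat) \<Rightarrow> real"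
  assumes "n > 0" "g \<in> carrier G" "h \<in> borel_measurable (bernoulli (carrier G) n)"
  shows "(\<integral>x. h (shift G g x) \<partial>bernoulli (carrier G) n) = (\<integral>x. h x \<partial>bernoulli (carrier G) n)"
  using integral_distr[OF measurable_shift[OF assms(2)] assms(3)] distr_shift[OF assms(1,2)] by simp

lemma integrable_shift:
  fixes h :: "('a \<Rightarrow> nat) \<Rightarrow> real"
  assumes "n > 0" "g \<in> carrier G" "integrable (bernoulli (carrier G) n) h"
  shows "integrable (bernoulli (carrier G) n) (\<lambda>x. h (shift G g x))"
  using integrable_distr[OF measurable_shift[OF assms(2)], of n h] distr_shift[OF assms(1,2)] assms(3)
  by simp

end

text \<open>The right-hand side bounds from below the mean log-weight of the true symbol when the
  decoded symbol gets weight 1 - e, every other one e/n, and the decoder errs with probability below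
  e. It tends to 0 with e because e ln e does.\<close>

lemma small_decoding_error:
  fixes c :: real and n :: nat
  assumes "c > 0" "n > 0"
  obtains e where "0 < e" "e < 1/2" "- c < ln (1 - e) + e * ln (e / real n)"
proof -
  have "((\<lambda>e. ln (1 - e) + e * ln (e / real n)) \<longlongrightarrow> 0) (at_right 0)"
    using assms(2) by real_asymp
  then have "\<forall>\<^sub>F e in at_right 0. - c < ln (1 - e) + e * ln (e / real n)"
    by (rule order_tendstoD) (use assms in simp)
  moreover have "\<forall>\<^sub>F e in at_right (0::real). 0 < e \<and> e < 1/2"
    by (auto simp: eventually_at_right_field intro: exI[of _ "1/2"])
  ultimately have "\<forall>\<^sub>F e in at_right (0::real). 0 < e \<and> e < 1/2 \<and> - c < ln (1 - e) + e * ln (e / real n)"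
    by eventually_elim simp
  from eventually_happens[OF this] show thesis using that by auto
qed

lemma measurable_restrict_comp:
  assumes "f \<in> M \<rightarrow>\<^sub>M bernoulli I n" "finite J" "J \<subseteq> I"
  shows "(\<lambda>x. restrict (f x) J) \<in> M \<rightarrow>\<^sub>M count_space (\<Pi>\<^sub>E i\<in>J. {..<n})"
  by (rule measurable_compose[OF assms(1) measurable_bernoulli_restrict[OF assms(2,3)]])

section \<open>The law of the image under an injective equivariant map\<close>

context group
begin

text \<open>If a pattern \<open>a\<close> over \<open>E\<close> were too frequent in \<open>f x\<close>, the density \<open>q\<close>, tilted towards \<open>a\<close>,
  would describe \<open>f x\<close> on a Folner set \<open>F'\<close> with fewer than \<open>|F'| ln n\<close> nats: \<open>R\<close> uses \<open>q\<close> on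
  disjoint translates of \<open>E\<close> and is uniform elsewhere. As \<open>\<phi>\<close> reads off \<open>x\<close> from \<open>f x\<close> with few
  errors, whose cost is accounted for by \<open>T\<close>, this violates the coding inequality.\<close>

lemma equivariant_injection_cylinder_le:
  fixes n :: nat
  defines "B \<equiv> bernoulli (carrier G) n"
  assumes amen: "amenable_group G" and count: "countable (carrier G)" and n: "n > 0"
    and D: "D \<in> sets B" "measure B D = 1"
    and f: "f \<in> B \<rightarrow>\<^sub>M B" and inj: "inj_on f D"
    and equi: "\<And>g x. g \<in> carrier G \<Longrightarrow> x \<in> space B \<Longrightarrow> f (shift G g x) = shift G g (f x)"
    and E: "finite E" "E \<subseteq> carrier G" and a: "a \<in> (\<Pi>\<^sub>E i\<in>E. {..<n})"
  shows "measure B {x \<in> space B. restrict (f x) E = a} \<le> 1 / real n ^ card E"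
proof (rule ccontr)
  interpret prob_space B unfolding B_def using n by (rule prob_space_bernoulli)
  let ?p = "prob {x \<in> space B. restrict (f x) E = a}" and ?N = "real n ^ card E"
  assume "\<not> ?thesis"
  then have p: "?p > 1 / ?N" by simp
  have "E \<noteq> {}"
  proof
    assume "E = {}"
    then have "1 / ?N = 1" by simp
    with p prob_le_1[of "{x \<in> space B. restrict (f x) E = a}"] show False by linarith
  qed
  then have cE: "card E > 0" using E by (simp add: card_gt_0_iff)
  have N: "?N \<ge> 1" using n by simp
  have finPi: "finite (\<Pi>\<^sub>E i\<in>J. {..<n})" if "finite J" for J :: "'a set"
    using that by (intro finite_PiE) auto
  have spB: "space B = (\<Pi>\<^sub>E i\<in>carrier G. {..<n})" unfolding B_def by (rule space_bernoulli)
  have fB: "f x \<in> space B" if "x \<in> space B" for x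
    using that measurable_space[OF f] by auto
  note mf = measurable_restrict_comp[OF f[unfolded B_def], folded B_def]

  define d where "d = ?p - 1 / ?N"
  have d: "0 < d" using p by (simp add: d_def)
  have "1 / ?N \<ge> 0" using n by simp
  with prob_le_1[of "{x \<in> space B. restrict (f x) E = a}"] have d1: "d \<le> 1"
    unfolding d_def by linarith
  note d = d d1
  \<comment> \<open>A density of mean 1 under the uniform law. The factor \<open>d / 4\<close> keeps
    the tilt s within 1/4, so \<open>q\<close> is positive and ln (1 + s) \<ge> s - 2 s^2 applies.
    The loss is at most d^2/8 against an expected gain of d^2/4, which leaves d^2/8.\<close>
  define q where "q u = 1 + d / 4 * ((if u = a then 1 else 0) - 1 / ?N)" for u :: "'a \<Rightarrow> nat"
  have t: "\<bar>(if u = a then 1 else 0) - 1 / ?N\<bar> \<le> 1" for u :: "'a \<Rightarrow> nat"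
  proof -
    have "\<bar>(if P then 1 else 0) - r\<bar> \<le> 1" if "0 \<le> r" "r \<le> 1" for P and r :: real
      using that by auto
    then show ?thesis using N by (simp add: divide_le_eq)
  qed
  have t': "\<bar>d / 4 * ((if u = a then 1 else 0) - 1 / ?N)\<bar> \<le> d / 4" for u :: "'a \<Rightarrow> nat"
    unfolding abs_mult using t[of u] d by (simp add: mult_left_le)
  have q: "q u > 0" for u using t'[of u] d unfolding q_def abs_le_iff by linarith
  have ln_q: "ln (q u) \<ge> d / 4 * ((if u = a then 1 else 0) - 1 / ?N) - d\<^sup>2 / 8" for u
  proof -
    define s where "s = d / 4 * ((if u = a then 1 else 0) - 1 / ?N)"
    have s: "\<bar>s\<bar> \<le> d / 4" unfolding s_def by (rule t')
    have "s\<^sup>2 \<le> (d / 4)\<^sup>2" using s d by (intro abs_le_square_iff[THEN iffD1]) auto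
    moreover have "\<bar>ln (1 + s) - s\<bar> \<le> 2 * s\<^sup>2"
      using s d by (intro abs_ln_one_plus_x_minus_x_bound) linarith
    ultimately show ?thesis unfolding q_def s_def[symmetric] by (simp add: power_divide abs_le_iff)
  qed
  have sum_q: "(\<Sum>u\<in>(\<Pi>\<^sub>E i\<in>E. {..<n}). q u) = ?N"
  proof -
    have "(\<Sum>u\<in>(\<Pi>\<^sub>E i\<in>E. {..<n}). (if u = a then 1 else 0) - 1 / ?N) = 0"
      using a finPi[OF E(1)] n E(1) by (simp add: sum_subtractf card_PiE)
    then show ?thesis
      unfolding q_def sum.distrib sum_distrib_left[symmetric] using E(1) by (simp add: card_PiE)
  qed

  define \<alpha> where "\<alpha> x = ln (q (restrict (f x) E))" for x
  have int_\<alpha>: "integrable B \<alpha>"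
    unfolding \<alpha>_def by (rule integrable_compose_count_space[OF finPi[OF E(1)] mf[OF E], of "\<lambda>u. ln (q u)"])
  have \<alpha>: "(\<integral>x. \<alpha> x \<partial>B) \<ge> d\<^sup>2 / 8"
  proof -
    have ev: "{x \<in> space B. restrict (f x) E = a} \<in> events"
      using measurable_sets[OF mf[OF E], of "{a}"] a by (simp add: vimage_def Int_def conj_commute)
    then have ind: "integrable B (indicator {x \<in> space B. restrict (f x) E = a} :: _ \<Rightarrow> real)"
      by (simp add: less_top[symmetric])
    have "d\<^sup>2 / 8 = d / 4 * (?p - 1 / ?N) - d\<^sup>2 / 8"
      by (simp add: d_def[symmetric] power2_eq_square)
    also have "\<dots> = (\<integral>x. d / 4 * (indicator {x \<in> space B. restrict (f x) E = a} x - 1 / ?N) - d\<^sup>2 / 8 \<partial>B)"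
      using ind ev by (simp add: prob_space)
    also have "\<dots> \<le> (\<integral>x. \<alpha> x \<partial>B)"
    proof (intro integral_mono int_\<alpha>)
      show "integrable B (\<lambda>x. d / 4 * (indicator {x \<in> space B. restrict (f x) E = a} x - 1 / ?N) - d\<^sup>2 / 8)"
        using ind by simp
      show "d / 4 * (indicator {x \<in> space B. restrict (f x) E = a} x - 1 / ?N) - d\<^sup>2 / 8 \<le> \<alpha> x"
        if "x \<in> space B" for x
        using ln_q[of "restrict (f x) E"] that by (auto simp: \<alpha>_def indicator_def)
    qed
    finally show ?thesis .
  qed

  \<comment> \<open>The packing \<open>J\<close> has at least |F| / |E|^2 members, each gaining
    d^2/8 on average, so the total gain is at least 2 c |F|. One half is the allowance for decoding
    errors, the other for the excess of |F'| over |F|.\<close>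
  define c where "c = d\<^sup>2 / 8 / (2 * (real (card E))\<^sup>2)"
  have c: "c > 0" using d cE by (simp add: c_def)
  obtain e where e: "0 < e" "e < 1/2" "- c < ln (1 - e) + e * ln (e / real n)"
    using small_decoding_error[OF c n] .
  obtain W \<phi> where W: "finite W" "W \<subseteq> carrier G"
    and err: "prob {x \<in> space B. \<phi> (restrict (f x) W) \<noteq> x \<one>} < e"
    using finite_window_decoder[OF n count one_closed D[unfolded B_def] f[unfolded B_def] inj e(1)]
    unfolding B_def by blast
  \<comment> \<open>The weight of the true symbol \<open>b\<close> given the guess
    \<open>b'\<close>. Errors keep positive weight so that logarithms stay finite. The weights sum
    to at most 1 for every guess, including a guess outside the alphabet.\<close>
  define \<tau> where "\<tau> b b' = (if b = b' then 1 - e else e / real n)" for b b' :: nat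
  have \<tau>: "\<tau> b b' > 0" for b b' using e n by (simp add: \<tau>_def)
  have sum_\<tau>: "(\<Sum>b<n. \<tau> b b') \<le> 1" for b'
  proof -
    have "(\<Sum>b<n. \<tau> b b') \<le> (\<Sum>b<n. (if b = b' then 1 - e else 0) + e / real n)"
      using e by (intro sum_mono) (auto simp: \<tau>_def)
    also have "\<dots> \<le> 1" using n e by (simp add: sum.distrib)
    finally show ?thesis .
  qed
  define \<beta> where "\<beta> x = ln (\<tau> (x \<one>) (\<phi> (restrict (f x) W)))" for x
  have m1: "(\<lambda>x. x \<one>) \<in> B \<rightarrow>\<^sub>M count_space {..<n}"
    unfolding B_def by (rule measurable_bernoulli_component) simp
  have int_\<beta>: "integrable B \<beta>"
    unfolding \<beta>_def
    by (rule integrable_compose_count_space2[OF _ finPi[OF W(1)] m1 mf[OF W], of "\<lambda>b u. ln (\<tau> b (\<phi> u))"]) simp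
  have \<beta>: "(\<integral>x. \<beta> x \<partial>B) > - c"
  proof -
    let ?Er = "{x \<in> space B. \<phi> (restrict (f x) W) \<noteq> x \<one>}"
    have "(\<lambda>x. (x \<one>, restrict (f x) W)) \<in> B \<rightarrow>\<^sub>M count_space ({..<n} \<times> (\<Pi>\<^sub>E i\<in>W. {..<n}))"
      using measurable_Pair[OF m1 mf[OF W]] finPi[OF W(1)] by (simp add: pair_measure_count_space)
    from measurable_sets[OF this, of "{(b, u) \<in> {..<n} \<times> (\<Pi>\<^sub>E i\<in>W. {..<n}). \<phi> u \<noteq> b}"]
    have "(\<lambda>x. (x \<one>, restrict (f x) W)) -` {(b, u) \<in> {..<n} \<times> (\<Pi>\<^sub>E i\<in>W. {..<n}). \<phi> u \<noteq> b} \<inter> space B \<in> events"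
      by auto
    also have "(\<lambda>x. (x \<one>, restrict (f x) W)) -` {(b, u) \<in> {..<n} \<times> (\<Pi>\<^sub>E i\<in>W. {..<n}). \<phi> u \<noteq> b} \<inter> space B = ?Er"
      using measurable_space[OF m1] measurable_space[OF mf[OF W]] by auto
    finally have ev: "?Er \<in> events" .
    then have ind: "integrable B (indicator ?Er :: _ \<Rightarrow> real)"
      by (simp add: less_top[symmetric])
    have en: "e / real n \<le> 1" using e n by (simp add: divide_le_eq)
    then have ln_neg: "ln (e / real n) \<le> 0" using e n by simp
    have "- c < ln (1 - e) + e * ln (e / real n)" by fact
    also have "\<dots> \<le> ln (1 - e) + prob ?Er * ln (e / real n)"
      using err ln_neg by (intro add_left_mono mult_right_mono_neg) auto
    also have "\<dots> = (\<integral>x. ln (1 - e) + indicator ?Er x * ln (e / real n) \<partial>B)"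
      using ind ev by (simp add: prob_space)
    also have "\<dots> \<le> (\<integral>x. \<beta> x \<partial>B)"
    proof (intro integral_mono int_\<beta>)
      show "integrable B (\<lambda>x. ln (1 - e) + indicator ?Er x * ln (e / real n))"
        using ind by simp
      show "ln (1 - e) + indicator ?Er x * ln (e / real n) \<le> \<beta> x" if "x \<in> space B" for x
        using that e by (auto simp: \<beta>_def \<tau>_def indicator_def)
    qed
    finally show ?thesis .
  qed

  \<comment> \<open>Chosen so that the excess |F'| - |F| costs at most c |F|; the added 1 keeps the
    denominator positive when \<open>n\<close> is 1.\<close>
  define \<kappa> where "\<kappa> = c / (1 + ln (real n))"
  have lnn: "ln (real n) \<ge> 0" using n by simp
  have \<kappa>: "\<kappa> > 0" "\<kappa> * ln (real n) \<le> c"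
    using c lnn by (auto simp: \<kappa>_def divide_le_eq)
  obtain F where F: "F \<subseteq> carrier G" "finite F" "F \<noteq> {}"
    and Fol: "real (card (\<Union>u\<in>W \<union> E. u <#\<^bsub>G\<^esub> F)) \<le> (1 + \<kappa>) * real (card F)"
    using folner_set[OF amen _ _ \<kappa>(1), of "W \<union> E"] W E by auto
  obtain J where J: "J \<subseteq> F" "disjoint_family_on (\<lambda>g. E #> g) J" "card F \<le> (card E)\<^sup>2 * card J"
    using disjoint_translates[OF E \<open>E \<noteq> {}\<close> F(2,1)] .
  \<comment> \<open>On WF and EF together, f x shows every window needed to decode \<open>x\<close>
    on \<open>F\<close> and every pattern over a translate Eg with \<open>g\<close> in
    \<open>J\<close>.\<close>
  define F' where "F' = (\<Union>u\<in>W \<union> E. u <#\<^bsub>G\<^esub> F)"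
  have F': "finite F'" "F' \<subseteq> carrier G"
    using F W E by (auto simp: F'_def l_coset_def)
  have inF': "u \<otimes> g \<in> F'" if "u \<in> W \<union> E" "g \<in> F" for u g
    using that by (auto simp: F'_def l_coset_def)
  have finJ: "finite J" using J(1) F(2) finite_subset by blast
  have gJ: "g \<in> carrier G" "g \<in> F" if "g \<in> J" for g using that J(1) F(1) by auto

  \<comment> \<open>The function sending \<open>h\<close> to \<open>v (h \<otimes> g)\<close> is
    what the shift by \<open>g\<close> brings into a window around the identity. So \<open>T\<close>
    applies the decoding channel at each site of \<open>F\<close>, and \<open>R\<close> collects the
    tilt along the packing.\<close>
  define V where "V x = restrict (f x) F'" for x
  define R where "R v = (\<Prod>g\<in>J. q (\<lambda>h\<in>E. v (h \<otimes> g))) / real n ^ card F'" for v :: "'a \<Rightarrow> nat"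
  define T where "T u v = (\<Prod>g\<in>F. \<tau> (u g) (\<phi> (\<lambda>h\<in>W. v (h \<otimes> g))))" for u v :: "'a \<Rightarrow> nat"

  have one: "(\<integral>x. q (\<lambda>h\<in>E. x (h \<otimes> g)) \<partial>B) = 1" if "g \<in> carrier G" for g
  proof -
    have rE: "(\<lambda>x. restrict x E) \<in> B \<rightarrow>\<^sub>M count_space (\<Pi>\<^sub>E i\<in>E. {..<n})"
      unfolding B_def by (rule measurable_bernoulli_restrict[OF E])
    have "(\<integral>x. q (\<lambda>h\<in>E. x (h \<otimes> g)) \<partial>B) = (\<integral>x. q (restrict (shift G g x) E) \<partial>B)"
      using E(2) by (intro Bochner_Integration.integral_cong refl arg_cong[where f = q])
        (auto simp: fun_eq_iff restrict_def shift_def)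
    also have "\<dots> = (\<integral>x. q (restrict x E) \<partial>B)"
      unfolding B_def
      by (rule integral_shift[OF n that, of "\<lambda>x. q (restrict x E)"])
         (rule measurable_compose[OF rE[unfolded B_def]], simp)
    also have "\<dots> = 1"
      unfolding B_def integral_bernoulli_restrict[OF n E] sum_q using n by simp
    finally show ?thesis .
  qed
  \<comment> \<open>With the factor n^-|F'| the sum is an integral against the uniform measure. The
    integrand is a product of densities of mean 1 on the disjoint windows Eg, so independence gives
    total mass 1.\<close>
  have sum_R: "(\<Sum>v\<in>(\<Pi>\<^sub>E i\<in>F'. {..<n}). R v) = 1"
  proof -
    have Eg: "finite (E #> g)" "E #> g \<subseteq> carrier G" if "g \<in> J" for g
      using E gJ(1)[OF that] by (auto simp: r_coset_def)
    have "(\<Sum>v\<in>(\<Pi>\<^sub>E i\<in>F'. {..<n}). R v) = (\<integral>x. (\<Prod>g\<in>J. q (\<lambda>h\<in>E. restrict x F' (h \<otimes> g))) \<partial>B)"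
      unfolding B_def integral_bernoulli_restrict[OF n F', of "\<lambda>v. \<Prod>g\<in>J. q (\<lambda>h\<in>E. v (h \<otimes> g))"]
      by (simp add: R_def sum_divide_distrib)
    also have "\<dots> = (\<integral>x. (\<Prod>g\<in>J. q (\<lambda>h\<in>E. restrict x (E #> g) (h \<otimes> g))) \<partial>B)"
      using inF' gJ by (intro Bochner_Integration.integral_cong refl prod.cong arg_cong[where f = q])
        (auto simp: fun_eq_iff restrict_def r_coset_def)
    also have "\<dots> = (\<Prod>g\<in>J. \<integral>x. q (\<lambda>h\<in>E. restrict x (E #> g) (h \<otimes> g)) \<partial>B)"
      unfolding B_def using Eg J(2)
      by (intro integral_bernoulli_prod[OF n finJ, of "\<lambda>g. E #> g" _ "\<lambda>g u. q (\<lambda>h\<in>E. u (h \<otimes> g))"]) auto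
    also have "\<dots> = (\<Prod>g\<in>J. \<integral>x. q (\<lambda>h\<in>E. x (h \<otimes> g)) \<partial>B)"
      by (intro prod.cong Bochner_Integration.integral_cong refl arg_cong[where f = q])
        (auto simp: fun_eq_iff restrict_def r_coset_def)
    also have "\<dots> = 1" using one gJ by (intro prod.neutral) auto
    finally show ?thesis .
  qed
  have sum_T: "(\<Sum>u\<in>(\<Pi>\<^sub>E i\<in>F. {..<n}). T u v) \<le> 1" for v
  proof -
    have "(\<Sum>u\<in>(\<Pi>\<^sub>E i\<in>F. {..<n}). T u v) = (\<Prod>g\<in>F. \<Sum>b<n. \<tau> b (\<phi> (\<lambda>h\<in>W. v (h \<otimes> g))))"
      unfolding T_def by (subst prod_sum_PiE) (use F in auto)
    also have "\<dots> \<le> 1"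
      using \<tau> sum_\<tau> by (intro prod_le_1) (auto intro!: sum_nonneg simp: less_imp_le)
    finally show ?thesis .
  qed
  have "(\<integral>x. ln (R (V x)) + ln (T (restrict x F) (V x)) \<partial>B) \<le> - (real (card F) * ln (real n))"
    unfolding B_def
  proof (rule coding_inequality[OF n F(2,1) finPi[OF F'(1)]])
    show "V \<in> bernoulli (carrier G) n \<rightarrow>\<^sub>M count_space (\<Pi>\<^sub>E i\<in>F'. {..<n})"
      unfolding V_def using mf[OF F'] by (simp add: B_def)
  qed (use q \<tau> n sum_R sum_T in \<open>auto simp: R_def T_def intro!: prod_pos divide_pos_pos\<close>)
  \<comment> \<open>Equivariance turns the window of f x at \<open>g\<close> into the window of
    f(g.x) at the identity. Both logarithms become sums of \<open>\<alpha>\<close> and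
    \<open>\<beta>\<close> along the orbit, and by invariance all summands of a sum have the same
    mean.\<close>
  also have "(\<integral>x. ln (R (V x)) + ln (T (restrict x F) (V x)) \<partial>B)
    = (\<integral>x. (\<Sum>g\<in>J. \<alpha> (shift G g x)) + (\<Sum>g\<in>F. \<beta> (shift G g x)) - real (card F') * ln (real n) \<partial>B)"
  proof (intro Bochner_Integration.integral_cong refl)
    fix x assume x: "x \<in> space B"
    have *: "(\<lambda>h\<in>U. V x (h \<otimes> g)) = restrict (f (shift G g x)) U" if "g \<in> F" "U \<subseteq> W \<union> E" for g U
    proof
      fix h
      show "(\<lambda>h\<in>U. V x (h \<otimes> g)) h = restrict (f (shift G g x)) U h"
      proof (cases "h \<in> U")
        case True
        then have "h \<in> carrier G" "g \<in> carrier G" "h \<otimes> g \<in> F'" using that W E F inF' by auto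
        then show ?thesis using True x by (simp add: V_def equi shift_apply)
      qed simp
    qed
    have "ln (R (V x)) = (\<Sum>g\<in>J. \<alpha> (shift G g x)) - real (card F') * ln (real n)"
    proof -
      have "ln (R (V x)) = ln (\<Prod>g\<in>J. q (\<lambda>h\<in>E. V x (h \<otimes> g))) - ln (real n ^ card F')"
        unfolding R_def using less_imp_neq[OF q, symmetric] n finJ by (subst ln_div) auto
      also have "ln (\<Prod>g\<in>J. q (\<lambda>h\<in>E. V x (h \<otimes> g))) = (\<Sum>g\<in>J. ln (q (\<lambda>h\<in>E. V x (h \<otimes> g))))"
        using finJ less_imp_neq[OF q, symmetric] by (intro ln_prod) auto
      also have "\<dots> = (\<Sum>g\<in>J. \<alpha> (shift G g x))"
        using * gJ by (intro sum.cong) (auto simp: \<alpha>_def)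
      finally show ?thesis using n by (simp add: ln_realpow)
    qed
    moreover have "ln (T (restrict x F) (V x)) = (\<Sum>g\<in>F. \<beta> (shift G g x))"
    proof -
      have "ln (T (restrict x F) (V x)) = (\<Sum>g\<in>F. ln (\<tau> (restrict x F g) (\<phi> (\<lambda>h\<in>W. V x (h \<otimes> g)))))"
        unfolding T_def using less_imp_neq[OF \<tau>, symmetric] F by (intro ln_prod) auto
      also have "\<dots> = (\<Sum>g\<in>F. \<beta> (shift G g x))"
        using * F by (intro sum.cong) (auto simp: \<beta>_def shift_apply)
      finally show ?thesis .
    qed
    ultimately show "ln (R (V x)) + ln (T (restrict x F) (V x))
      = (\<Sum>g\<in>J. \<alpha> (shift G g x)) + (\<Sum>g\<in>F. \<beta> (shift G g x)) - real (card F') * ln (real n)" by simp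
  qed
  also have "\<dots> = (\<Sum>g\<in>J. \<integral>x. \<alpha> x \<partial>B) + (\<Sum>g\<in>F. \<integral>x. \<beta> x \<partial>B) - real (card F') * ln (real n)"
  proof -
    have i: "integrable B (\<lambda>x. \<alpha> (shift G g x))" "integrable B (\<lambda>x. \<beta> (shift G g x))"
      "(\<integral>x. \<alpha> (shift G g x) \<partial>B) = (\<integral>x. \<alpha> x \<partial>B)" "(\<integral>x. \<beta> (shift G g x) \<partial>B) = (\<integral>x. \<beta> x \<partial>B)"
      if "g \<in> carrier G" for g
      using integrable_shift[OF n that] integral_shift[OF n that] int_\<alpha> int_\<beta>
      by (auto simp: B_def)
    have "integrable B (\<lambda>x. \<Sum>g\<in>J. \<alpha> (shift G g x))" "integrable B (\<lambda>x. \<Sum>g\<in>F. \<beta> (shift G g x))"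
      using i gJ F(1) by (auto intro!: Bochner_Integration.integrable_sum)
    moreover have "(\<integral>x. (\<Sum>g\<in>J. \<alpha> (shift G g x)) \<partial>B) = (\<Sum>g\<in>J. \<integral>x. \<alpha> (shift G g x) \<partial>B)"
      by (rule Bochner_Integration.integral_sum) (use i gJ in auto)
    moreover have "\<dots> = (\<Sum>g\<in>J. \<integral>x. \<alpha> x \<partial>B)"
      by (intro sum.cong refl i gJ)
    moreover have "(\<integral>x. (\<Sum>g\<in>F. \<beta> (shift G g x)) \<partial>B) = (\<Sum>g\<in>F. \<integral>x. \<beta> (shift G g x) \<partial>B)"
      by (rule Bochner_Integration.integral_sum) (use i F in auto)
    moreover have "\<dots> = (\<Sum>g\<in>F. \<integral>x. \<beta> x \<partial>B)"
      by (intro sum.cong refl i) (use F in auto)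
    ultimately show ?thesis by (simp add: prob_space)
  qed
  \<comment> \<open>The uniform cost |F'| ln n contained in \<open>R\<close> meets the lower bound
    |F| ln n, so only the excess of \<open>F'\<close> is left to offset the gain.\<close>
  finally have main: "real (card J) * (\<integral>x. \<alpha> x \<partial>B) + real (card F) * (\<integral>x. \<beta> x \<partial>B)
      \<le> (real (card F') - real (card F)) * ln (real n)"
    by (simp add: algebra_simps)
  have cF: "real (card F) > 0" using F by (simp add: card_gt_0_iff)
  have "(real (card F') - real (card F)) * ln (real n) \<le> (\<kappa> * real (card F)) * ln (real n)"
    using Fol lnn unfolding F'_def[symmetric] by (intro mult_right_mono) (auto simp: algebra_simps)
  also have "\<dots> = real (card F) * (\<kappa> * ln (real n))" by simp
  also have "\<dots> \<le> real (card F) * c" using \<kappa>(2) cF by simp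
  finally have upper: "(real (card F') - real (card F)) * ln (real n) \<le> real (card F) * c" .
  have "real (card F) * (2 * c) = real (card F) * (d\<^sup>2 / 8) / (real (card E))\<^sup>2"
    by (simp add: c_def)
  also have "\<dots> \<le> real (card J) * (d\<^sup>2 / 8)"
  proof -
    have "real (card F) \<le> (real (card E))\<^sup>2 * real (card J)"
      using J(3) by (metis of_nat_le_iff of_nat_mult of_nat_power)
    then have "real (card F) * (d\<^sup>2 / 8) \<le> (real (card E))\<^sup>2 * real (card J) * (d\<^sup>2 / 8)"
      by (intro mult_right_mono) auto
    then show ?thesis using cE by (simp add: divide_le_eq mult_ac)
  qed
  also have "\<dots> \<le> real (card J) * (\<integral>x. \<alpha> x \<partial>B)" using \<alpha> by (intro mult_left_mono) auto
  finally have "real (card F) * (2 * c) \<le> real (card J) * (\<integral>x. \<alpha> x \<partial>B)" .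
  \<comment> \<open>The contradiction comes from strictness here: a gain of at least 2 c |F|, minus
    an error cost strictly below c |F|, would be at most c |F|.\<close>
  moreover have "real (card F) * (\<integral>x. \<beta> x \<partial>B) > real (card F) * (- c)"
    using \<beta> cF by (intro mult_strict_left_mono)
  ultimately show False using main upper by (simp add: algebra_simps)
qed

text \<open>The upper bounds for the n^|E| cylinders over \<open>E\<close> add up to 1, and so do
  the probabilities themselves, so every bound is attained. Agreement on cylinders identifies the
  measure.\<close>

theorem equivariant_injection_preserves_bernoulli:
  fixes n :: nat
  defines "B \<equiv> bernoulli (carrier G) n"
  assumes amen: "amenable_group G" and count: "countable (carrier G)" and n: "n > 0"
    and D: "D \<in> sets B" "measure B D = 1"
    and f: "f \<in> B \<rightarrow>\<^sub>M B" and inj: "inj_on f D"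
    and equi: "\<And>g x. g \<in> carrier G \<Longrightarrow> x \<in> space B \<Longrightarrow> f (shift G g x) = shift G g (f x)"
  shows "distr B B f = B"
proof -
  interpret prob_space B unfolding B_def using n by (rule prob_space_bernoulli)
  have "distr B B f = bernoulli (carrier G) n"
  proof (rule bernoulli_eqI[OF n prob_space_distr[OF f]])
    show "sets (distr B B f) = sets (bernoulli (carrier G) n)" by (simp add: B_def)
    fix E a assume E: "finite E" "E \<subseteq> carrier G" and a: "a \<in> (\<Pi>\<^sub>E i\<in>E. {..<n})"
    let ?P = "\<Pi>\<^sub>E i\<in>E. {..<n}" and ?C = "\<lambda>u. {x \<in> space B. restrict (f x) E = u}"
    have fin: "finite ?P" using E by (intro finite_PiE) auto
    note mf = measurable_restrict_comp[OF f[unfolded B_def] E, folded B_def]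
    have ev: "?C u \<in> events" if "u \<in> ?P" for u
      using measurable_sets[OF mf, of "{u}"] that by (simp add: vimage_def Int_def conj_commute)
    have "prob (\<Union>u\<in>?P. ?C u) = (\<Sum>u\<in>?P. prob (?C u))"
      using fin ev by (intro finite_measure_finite_Union) (auto simp: disjoint_family_on_def)
    moreover have "(\<Union>u\<in>?P. ?C u) = space B"
      using measurable_space[OF mf] by auto
    ultimately have "(\<Sum>u\<in>?P. prob (?C u)) = (\<Sum>u\<in>?P. 1 / real n ^ card E)"
      using n E by (simp add: prob_space card_PiE)
    then have "prob (?C a) = 1 / real n ^ card E"
    proof (rule sum_mono_inv)
      show "prob (?C u) \<le> 1 / real n ^ card E" if "u \<in> ?P" for u
        using equivariant_injection_cylinder_le[OF amen count n D[unfolded B_def] f[unfolded B_def] inj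
          equi[unfolded B_def] E that] by (simp add: B_def)
    qed (use a fin in auto)
    moreover have "measure (distr B B f) {x \<in> space (distr B B f). restrict x E = a} = prob (?C a)"
    proof -
      have rE: "(\<lambda>x. restrict x E) \<in> B \<rightarrow>\<^sub>M count_space ?P"
        unfolding B_def by (rule measurable_bernoulli_restrict[OF E])
      have "{x \<in> space B. restrict x E = a} \<in> events"
        using measurable_sets[OF rE, of "{a}"] a by (simp add: vimage_def Int_def conj_commute)
      then show ?thesis
        using measurable_space[OF f] by (subst measure_distr[OF f]) (auto intro!: arg_cong[where f = prob])
    qed
    ultimately show "measure (distr B B f) {x \<in> space (distr B B f). restrict x E = a} = 1 / real n ^ card E"
      by simp
  qed
  then show ?thesis by (simp add: B_def)
qed

end

section \<open>The free part of the shift\<close>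

lemma space_full_shift: "space (full_shift G n) = space (bernoulli (carrier G) n)"
  by (simp add: full_shift_def space_PiM space_bernoulli)

lemma sets_full_shift: "sets (full_shift G n) = sets (bernoulli (carrier G) n)"
  by (simp add: full_shift_def sets_bernoulli)

context group
begin

lemma shift_shift:
  "g \<in> carrier G \<Longrightarrow> h \<in> carrier G \<Longrightarrow> shift G g (shift G h x) = shift G (g \<otimes> h) x"
  by (auto simp: shift_def fun_eq_iff m_assoc)

lemma shift_one: "x \<in> space (full_shift G n) \<Longrightarrow> shift G \<one> x = x"
  by (auto simp: shift_def fun_eq_iff space_full_shift space_bernoulli PiE_iff extensional_def)

lemma shift_in_space:
  "g \<in> carrier G \<Longrightarrow> x \<in> space (full_shift G n) \<Longrightarrow> shift G g x \<in> space (full_shift G n)"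
  using measurable_space[OF measurable_shift] unfolding space_full_shift .

lemma shift_fixed_iff:
  assumes "x \<in> space (full_shift G n)"
  shows "shift G g x = x \<longleftrightarrow> (\<forall>h\<in>carrier G. x (h \<otimes> g) = x h)"
  using assms by (auto simp: shift_def fun_eq_iff space_full_shift space_bernoulli PiE_iff extensional_def)

lemma measurable_shift_fixed:
  assumes "countable (carrier G)" "g \<in> carrier G"
  shows "{x \<in> space (full_shift G n). shift G g x = x} \<in> sets (bernoulli (carrier G) n)"
proof -
  let ?B = "bernoulli (carrier G) n"
  have co: "(\<lambda>x. real (x h)) \<in> borel_measurable ?B" if "h \<in> carrier G" for h
    by (rule measurable_compose[OF measurable_bernoulli_component[OF that]]) simp
  have "{x \<in> space ?B. \<forall>h\<in>carrier G. x (h \<otimes> g) = x h} \<in> sets ?B"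
  proof (rule sets.sets_Collect_countable_All'[OF _ assms(1)])
    fix h assume h: "h \<in> carrier G"
    have "{x \<in> space ?B. real (x (h \<otimes> g)) = real (x h)} \<in> sets ?B"
      using h assms(2) by (intro measurable_equality_set co) auto
    then show "{x \<in> space ?B. x (h \<otimes> g) = x h} \<in> sets ?B" by simp
  qed
  then show ?thesis
    by (simp add: shift_fixed_iff space_full_shift[symmetric] cong: conj_cong)
qed

lemma free_part_eq:
  "free_part G n = space (full_shift G n)
    - (\<Union>g\<in>carrier G - {\<one>}. {x \<in> space (full_shift G n). shift G g x = x})"
  by (auto simp: free_part_def)

lemma free_part_sets:
  assumes "countable (carrier G)"
  shows "free_part G n \<in> sets (bernoulli (carrier G) n)"
  unfolding free_part_eq space_full_shift
  using assms measurable_shift_fixed[OF assms, of _ n]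
  by (intro sets.Diff sets.top sets.countable_UN') (auto simp: space_full_shift)

text \<open>A point fixed by \<open>g\<close> has equal symbols at inv k and inv k g for every k. An
  infinite group contains arbitrarily many disjoint pairs of this form, and the corresponding events
  are independent with probabilities bounded away from 1.\<close>

lemma measure_shift_fixed:
  assumes count: "countable (carrier G)" and inf: "infinite (carrier G)" and n: "n \<ge> 2"
    and g: "g \<in> carrier G" "g \<noteq> \<one>"
  shows "measure (bernoulli (carrier G) n) {x \<in> space (full_shift G n). shift G g x = x} = 0"
proof -
  let ?B = "bernoulli (carrier G) n" and ?A = "{x \<in> space (full_shift G n). shift G g x = x}"
  have n0: "n > 0" using n by simp
  interpret prob_space ?B using n0 by (rule prob_space_bernoulli)
  \<comment> \<open>Excluding just one pattern with two different symbols already bounds the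
    probability of agreement on a pair below 1; two symbols exist because \<open>n\<close> is at
    least 2.\<close>
  define r where "r = 1 - 1 / real n ^ 2"
  have r: "0 \<le> r" "r < 1" using n by (auto simp: r_def divide_le_eq power2_eq_square mult_ge1_I)
  have bound: "prob ?A \<le> r ^ m" for m
  proof -
    \<comment> \<open>The packing loses a factor of at most |E|^2 \<le> 4, so 4 m elements leave at
      least m disjoint pairs.\<close>
    obtain F where F: "F \<subseteq> carrier G" "finite F" "card F = 4 * m"
      using inf infinite_arbitrarily_large by blast
    let ?E = "{\<one>, inv g}"
    have E: "finite ?E" "?E \<subseteq> carrier G" "?E \<noteq> {}" "card ?E \<le> 2"
      using g by (auto simp: card_insert_if)
    obtain J where J: "J \<subseteq> F" "disjoint_family_on (\<lambda>k. ?E #> k) J" "card F \<le> (card ?E)\<^sup>2 * card J"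
      using disjoint_translates[OF E(1-3) F(2,1)] .
    have "4 * m \<le> (card ?E)\<^sup>2 * card J" using J(3) F(3) by simp
    also have "\<dots> \<le> 2\<^sup>2 * card J" using E(4) by (intro mult_right_mono power_mono) auto
    finally have mJ: "m \<le> card J" by simp
    have finJ: "finite J" using J(1) F(2) finite_subset by blast
    have JG: "k \<in> carrier G" if "k \<in> J" for k using that J(1) F(1) by auto
    \<comment> \<open>Inverting right translates of \<open>{\<one>, inv g}\<close> turns them into left translates of \<open>{\<one>, g}\<close>.\<close>
    define b where "b k = {inv k, inv k \<otimes> g}" for k
    have b: "b k = m_inv G ` (?E #> k)" if "k \<in> J" for k
      using JG[OF that] g by (auto simp: b_def r_coset_def inv_mult_group)
    have disj: "disjoint_family_on b J"
      unfolding disjoint_family_on_def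
    proof (intro ballI impI)
      fix k l assume kl: "k \<in> J" "l \<in> J" "k \<noteq> l"
      have "(?E #> k) \<inter> (?E #> l) = {}"
        using disjoint_family_onD[OF J(2) kl] .
      moreover have "?E #> k \<subseteq> carrier G" "?E #> l \<subseteq> carrier G"
        using E(2) JG kl by (auto simp: r_coset_def)
      ultimately show "b k \<inter> b l = {}"
        using kl inj_on_image_Int[OF inv_inj, of "?E #> k" "?E #> l"] by (simp add: b)
    qed
    define q where "q k u = (if u (inv k \<otimes> g) = u (inv k) then 1 else 0 :: real)"
      for k and u :: "'a \<Rightarrow> nat"
    have bG: "finite (b k)" "b k \<subseteq> carrier G" if "k \<in> J" for k
      using JG[OF that] g by (auto simp: b_def)
    have fin: "finite (\<Pi>\<^sub>E i\<in>b k. {..<n})" for k by (intro finite_PiE) (auto simp: b_def)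
    have q_int: "integrable ?B (\<lambda>x. q k (restrict x (b k)))" if "k \<in> J" for k
      by (rule integrable_compose_count_space[OF fin measurable_bernoulli_restrict[OF bG[OF that]]])
    have q_le: "(\<integral>x. q k (restrict x (b k)) \<partial>?B) \<le> r" if k: "k \<in> J" for k
    proof -
      have ne: "inv k \<otimes> g \<noteq> inv k" using JG[OF k] g by simp
      then have card: "card (b k) = 2" by (simp add: b_def)
      define u where "u = (\<lambda>h\<in>b k. if h = inv k then 0 else 1 :: nat)"
      have u: "u \<in> (\<Pi>\<^sub>E i\<in>b k. {..<n})" using n by (auto simp: u_def)
      let ?C = "{x \<in> space ?B. restrict x (b k) = u}"
      have C: "?C \<in> events"
        using measurable_sets[OF measurable_bernoulli_restrict[OF bG[OF k]], of "{u}" n] u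
        by (simp add: vimage_def Int_def conj_commute)
      have uk: "u (inv k) = 0" "u (inv k \<otimes> g) = 1" using ne by (auto simp: u_def b_def)
      have "(\<integral>x. q k (restrict x (b k)) \<partial>?B) \<le> (\<integral>x. 1 - indicator ?C x \<partial>?B)"
      proof (rule integral_mono[OF q_int[OF k]])
        show "integrable ?B (\<lambda>x. 1 - indicator ?C x :: real)" using C by (simp add: less_top[symmetric])
        show "q k (restrict x (b k)) \<le> 1 - indicator ?C x" if "x \<in> space ?B" for x
        proof (cases "restrict x (b k) = u")
          case True
          then show ?thesis using uk by (simp add: q_def)
        qed (auto simp: q_def)
      qed
      also have "\<dots> = 1 - prob ?C" using C by (simp add: prob_space less_top[symmetric])
      also have "\<dots> = r" using measure_bernoulli_cylinder[OF n0 bG[OF k] u] card by (simp add: r_def)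
      finally show ?thesis .
    qed
    have A: "?A \<in> events" using measurable_shift_fixed[OF count g(1)] .
    have "prob ?A = (\<integral>x. indicator ?A x \<partial>?B)" using A by simp
    also have "\<dots> \<le> (\<integral>x. (\<Prod>k\<in>J. q k (restrict x (b k))) \<partial>?B)"
    proof (rule integral_mono)
      show "integrable ?B (indicator ?A :: _ \<Rightarrow> real)" using A by (simp add: less_top[symmetric])
      have UG: "finite (\<Union>(b ` J))" "\<Union>(b ` J) \<subseteq> carrier G" using bG finJ by auto
      have "integrable ?B (\<lambda>x. \<Prod>k\<in>J. q k (restrict (restrict x (\<Union>(b ` J))) (b k)))"
        by (rule integrable_compose_count_space[OF _ measurable_bernoulli_restrict[OF UG],
            where h = "\<lambda>u. \<Prod>k\<in>J. q k (restrict u (b k))"]) (use UG in \<open>intro finite_PiE; simp\<close>)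
      moreover have "restrict (restrict x (\<Union>(b ` J))) (b k) = restrict x (b k)"
        if "k \<in> J" for x :: "'a \<Rightarrow> nat" and k
        using that by (auto simp: fun_eq_iff restrict_def)
      ultimately show "integrable ?B (\<lambda>x. \<Prod>k\<in>J. q k (restrict x (b k)))"
        by (simp only: cong: prod.cong)
      fix x assume x: "x \<in> space ?B"
      show "indicator ?A x \<le> (\<Prod>k\<in>J. q k (restrict x (b k)))"
      proof (cases "x \<in> ?A")
        case True
        then have "\<forall>h\<in>carrier G. x (h \<otimes> g) = x h"
          using shift_fixed_iff[of x n g] by auto
        then have "q k (restrict x (b k)) = 1" if "k \<in> J" for k
          using JG[OF that] by (simp add: q_def b_def)
        then show ?thesis by (simp add: indicator_def)
      next
        case False
        moreover have "0 \<le> (\<Prod>k\<in>J. q k (restrict x (b k)))" by (intro prod_nonneg) (simp add: q_def)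
        ultimately show ?thesis by simp
      qed
    qed
    also have "\<dots> = (\<Prod>k\<in>J. \<integral>x. q k (restrict x (b k)) \<partial>?B)"
      using bG disj by (intro integral_bernoulli_prod[OF n0 finJ]) auto
    also have "\<dots> \<le> (\<Prod>k\<in>J. r)"
      using q_le by (intro prod_mono conjI integral_nonneg) (auto simp: q_def)
    also have "\<dots> = r ^ card J" by simp
    also have "\<dots> \<le> r ^ m" using r mJ by (intro power_decreasing) auto
    finally show ?thesis .
  qed
  have "(\<lambda>m. r ^ m) \<longlonglongrightarrow> 0" using r by (intro LIMSEQ_power_zero) auto
  then have "prob ?A \<le> 0" by (rule LIMSEQ_le_const) (use bound in blast)
  then show ?thesis by (simp add: measure_le_0_iff)
qed

lemma measure_free_part:
  assumes count: "countable (carrier G)" and inf: "infinite (carrier G)" and n: "n \<ge> 2"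
  shows "measure (bernoulli (carrier G) n) (free_part G n) = 1"
proof -
  let ?B = "bernoulli (carrier G) n"
  interpret prob_space ?B by (rule prob_space_bernoulli) (use n in simp)
  let ?A = "\<lambda>g. {x \<in> space (full_shift G n). shift G g x = x}"
  have "?A g \<in> null_sets ?B" if "g \<in> carrier G - {\<one>}" for g
    using that measure_shift_fixed[OF assms, of g] measurable_shift_fixed[OF count, of g n]
    by (auto simp: emeasure_eq_measure intro!: null_setsI)
  then have "(\<Union>g\<in>carrier G - {\<one>}. ?A g) \<in> null_sets ?B"
    using count by (intro null_sets_UN') auto
  then have "prob (space ?B - (\<Union>g\<in>carrier G - {\<one>}. ?A g)) = 1"
    by (subst prob_compl) (auto simp: measure_eq_0_null_sets)
  then show ?thesis by (simp add: free_part_eq space_full_shift)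
qed

end

section \<open>Automorphisms of the Schreier graph\<close>

text \<open>No edge leaves \<open>U\<close>, so extending \<open>\<alpha>\<close> by the identity
  gives an automorphism of the whole graph.\<close>

lemma distinguishing_invariant_set:
  assumes dist: "\<forall>\<psi>\<in>graph_aut V E. (\<forall>x\<in>V. c (\<psi> x) = c x) \<longrightarrow> \<psi> = (\<lambda>x\<in>V. x)"
    and "U \<subseteq> V" and closed: "\<And>u v. u \<in> U \<Longrightarrow> v \<in> V \<Longrightarrow> (u, v) \<in> E \<or> (v, u) \<in> E \<Longrightarrow> v \<in> U"
    and bij: "bij_betw \<alpha> U U"
    and edges: "\<And>u v. u \<in> U \<Longrightarrow> v \<in> U \<Longrightarrow> (\<alpha> u, \<alpha> v) \<in> E \<longleftrightarrow> (u, v) \<in> E"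
    and colors: "\<And>u. u \<in> U \<Longrightarrow> c (\<alpha> u) = c u"
    and "u \<in> U"
  shows "\<alpha> u = u"
proof -
  define \<psi> where "\<psi> = (\<lambda>v\<in>V. if v \<in> U then \<alpha> v else v)"
  have \<alpha>U: "\<alpha> v \<in> U" if "v \<in> U" for v using bij that by (auto dest: bij_betwE)
  have "bij_betw (\<lambda>v. if v \<in> U then \<alpha> v else v) (U \<union> (V - U)) (U \<union> (V - U))"
    using bij by (rule bij_betw_disjoint_Un) (auto simp: bij_betw_def)
  moreover have UV: "U \<union> (V - U) = V" using \<open>U \<subseteq> V\<close> by auto
  ultimately have "bij_betw (\<lambda>v. if v \<in> U then \<alpha> v else v) V V" unfolding UV by simp
  then have "bij_betw \<psi> V V"
    unfolding \<psi>_def by (simp cong: bij_betw_cong)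
  then have "\<psi> \<in> Bij V" by (simp add: Bij_def \<psi>_def)
  moreover have "(\<psi> v, \<psi> w) \<in> E \<longleftrightarrow> (v, w) \<in> E" if "v \<in> V" "w \<in> V" for v w
    using that edges closed \<alpha>U \<open>U \<subseteq> V\<close> by (auto simp: \<psi>_def) blast+
  ultimately have "\<psi> \<in> graph_aut V E" by (simp add: graph_aut_def)
  moreover have "\<forall>x\<in>V. c (\<psi> x) = c x" using colors by (auto simp: \<psi>_def)
  ultimately have "\<psi> = (\<lambda>x\<in>V. x)" using dist by blast
  then have "\<psi> u = u" using \<open>u \<in> U\<close> \<open>U \<subseteq> V\<close> by auto
  then show ?thesis using \<open>u \<in> U\<close> \<open>U \<subseteq> V\<close> by (auto simp: \<psi>_def)
qed

text \<open>If the two sets differ, swapping them by \<open>\<alpha>\<close> and its inverse gives a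
  color-preserving automorphism that moves every vertex of \<open>U\<close>. So the conclusion also
  says that distinct components are never isomorphic as colored graphs.\<close>

lemma distinguishing_isomorphic_components:
  assumes dist: "\<forall>\<psi>\<in>graph_aut V E. (\<forall>x\<in>V. c (\<psi> x) = c x) \<longrightarrow> \<psi> = (\<lambda>x\<in>V. x)"
    and sub: "U \<subseteq> V" "W \<subseteq> V" "U = W \<or> U \<inter> W = {}"
    and closedU: "\<And>u v. u \<in> U \<Longrightarrow> v \<in> V \<Longrightarrow> (u, v) \<in> E \<or> (v, u) \<in> E \<Longrightarrow> v \<in> U"
    and closedW: "\<And>u v. u \<in> W \<Longrightarrow> v \<in> V \<Longrightarrow> (u, v) \<in> E \<or> (v, u) \<in> E \<Longrightarrow> v \<in> W"
    and bij: "bij_betw \<alpha> U W"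
    and edges: "\<And>u v. u \<in> U \<Longrightarrow> v \<in> U \<Longrightarrow> (\<alpha> u, \<alpha> v) \<in> E \<longleftrightarrow> (u, v) \<in> E"
    and colors: "\<And>u. u \<in> U \<Longrightarrow> c (\<alpha> u) = c u"
    and u: "u \<in> U"
  shows "\<alpha> u = u"
proof (cases "U = W")
  case True
  with bij have "bij_betw \<alpha> U U" by simp
  from distinguishing_invariant_set[OF dist sub(1) closedU this edges colors u] show ?thesis .
next
  case False
  then have disj: "U \<inter> W = {}" using sub(3) by simp
  define \<beta> where "\<beta> = inv_into U \<alpha>"
  define \<sigma> where "\<sigma> v = (if v \<in> U then \<alpha> v else \<beta> v)" for v
  have bij\<beta>: "bij_betw \<beta> W U" unfolding \<beta>_def using bij by (rule bij_betw_inv_into)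
  have \<alpha>: "\<alpha> v \<in> W" if "v \<in> U" for v using bij that by (auto dest: bij_betwE)
  have \<beta>: "\<beta> w \<in> U" "\<alpha> (\<beta> w) = w" if "w \<in> W" for w
    using bij\<beta> that bij_betw_inv_into_right[OF bij that] by (auto dest: bij_betwE simp: \<beta>_def)
  have nU: "w \<notin> U" if "w \<in> W" for w using disj that by auto
  have "\<sigma> u = u"
  proof (rule distinguishing_invariant_set[OF dist, where U = "U \<union> W"])
    show "U \<union> W \<subseteq> V" using sub by simp
    show "v \<in> U \<union> W" if "w \<in> U \<union> W" "v \<in> V" "(w, v) \<in> E \<or> (v, w) \<in> E" for v w
      using that closedU closedW by blast
    have "bij_betw (\<lambda>v. if v \<in> U then \<alpha> v else \<beta> v) (U \<union> W) (W \<union> U)"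
      using bij bij\<beta> by (rule bij_betw_disjoint_Un) (use disj in auto)
    then have "bij_betw \<sigma> (U \<union> W) (W \<union> U)" unfolding \<sigma>_def[abs_def] .
    then show "bij_betw \<sigma> (U \<union> W) (U \<union> W)" by (simp add: Un_commute)
    show "(\<sigma> v, \<sigma> w) \<in> E \<longleftrightarrow> (v, w) \<in> E" if vw: "v \<in> U \<union> W" "w \<in> U \<union> W" for v w
    proof -
      have "(v, w) \<notin> E" "(w, v) \<notin> E" if "v \<in> U" "w \<in> W" for v w
        using that closedU sub nU by blast+
      moreover have "(\<beta> v, \<beta> w) \<in> E \<longleftrightarrow> (v, w) \<in> E" if "v \<in> W" "w \<in> W" for v w
        using edges[of "\<beta> v" "\<beta> w"] \<beta> that by simp
      ultimately show ?thesis using vw edges \<alpha> \<beta> nU by (auto simp: \<sigma>_def)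
    qed
    show "c (\<sigma> v) = c v" if "v \<in> U \<union> W" for v
      using that colors nU colors[OF \<beta>(1)] \<beta>(2) by (auto simp: \<sigma>_def)
    show "u \<in> U \<union> W" using u by simp
  qed
  then have "\<alpha> u = u" using u by (simp add: \<sigma>_def)
  \<comment> \<open>This case is contradictory: a fixed vertex would lie in both of the disjoint
    sets.\<close>
  with \<alpha>[OF u] u disj show ?thesis by auto
qed

section \<open>Orbits of the free part as copies of the Cayley graph\<close>

locale cayley_generators = group G for G (structure) +
  fixes S
  assumes S_sub: "S \<subseteq> carrier G" and gen: "generate G S = carrier G"
    and S_inv: "\<And>s. s \<in> S \<Longrightarrow> inv s \<in> S" and S_one: "\<one> \<notin> S"
begin

abbreviation "orb x \<equiv> (\<lambda>g. shift G g x) ` carrier G"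

lemma free_part_space: "x \<in> free_part G n \<Longrightarrow> x \<in> space (full_shift G n)"
  by (simp add: free_part_def)

lemma free_part_shift_inj:
  assumes x: "x \<in> free_part G n" and g: "g \<in> carrier G" "h \<in> carrier G" "shift G g x = shift G h x"
  shows "g = h"
proof -
  have "shift G (inv h \<otimes> g) x = shift G (inv h) (shift G g x)" using g(1,2) by (simp add: shift_shift)
  also have "\<dots> = x" unfolding g(3) using g(2) x by (simp add: shift_shift shift_one[OF free_part_space])
  finally have "inv h \<otimes> g = \<one>" using x g by (auto simp: free_part_def)
  then show ?thesis using g by (metis inv_equality inv_inv inv_closed)
qed

lemma free_part_shift:
  assumes x: "x \<in> free_part G n" and g: "g \<in> carrier G"
  shows "shift G g x \<in> free_part G n"
  unfolding free_part_def
proof (intro CollectI conjI ballI)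
  show "shift G g x \<in> space (full_shift G n)"
    using shift_in_space[OF g free_part_space[OF x]] .
  fix h assume h: "h \<in> carrier G - {\<one>}"
  show "shift G h (shift G g x) \<noteq> shift G g x"
  proof
    assume "shift G h (shift G g x) = shift G g x"
    then have "h \<otimes> g = g" using free_part_shift_inj[OF x, of "h \<otimes> g" g] g h by (simp add: shift_shift)
    then show False using g h by simp
  qed
qed

text \<open>By freeness the orbit map of \<open>x\<close> identifies the Cayley graph with the
  orbit. The two edge relations apply the generator at opposite ends, s g = h against g = s h, and
  symmetry of \<open>S\<close> reconciles them.\<close>

lemma schreier_edge_iff:
  assumes x: "x \<in> free_part G n" and g: "g \<in> carrier G" "h \<in> carrier G"
  shows "(shift G g x, shift G h x) \<in> schreier_edges G S n \<longleftrightarrow> (g, h) \<in> cayley_edges G S"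
proof -
  have 1: "shift G g x = shift G h x \<longleftrightarrow> g = h" using free_part_shift_inj[OF x g] by auto
  have 2: "(\<exists>s\<in>S. shift G s (shift G g x) = shift G h x) \<longleftrightarrow> (\<exists>s\<in>S. g = s \<otimes> h)"
  proof
    assume "\<exists>s\<in>S. shift G s (shift G g x) = shift G h x"
    then obtain s where s: "s \<in> S" "shift G s (shift G g x) = shift G h x" by blast
    then have "s \<otimes> g = h"
      using S_sub g free_part_shift_inj[OF x, of "s \<otimes> g" h] by (auto simp: shift_shift)
    then have "g = inv s \<otimes> h" using s S_sub g by (auto simp: m_assoc[symmetric])
    then show "\<exists>s\<in>S. g = s \<otimes> h" using S_inv s by blast
  next
    assume "\<exists>s\<in>S. g = s \<otimes> h"
    then obtain s where s: "s \<in> S" "g = s \<otimes> h" by blast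
    then have "inv s \<otimes> g = h" using S_sub g by (auto simp: m_assoc[symmetric])
    then have "shift G (inv s) (shift G g x) = shift G h x"
      using S_sub s g by (subst shift_shift) auto
    then show "\<exists>s\<in>S. shift G s (shift G g x) = shift G h x" using S_inv s by blast
  qed
  show ?thesis
    using 1 2 g free_part_shift[OF x] by (simp add: schreier_edges_def cayley_edges_def)
qed

lemma orb_subset: "x \<in> free_part G n \<Longrightarrow> orb x \<subseteq> free_part G n"
  using free_part_shift by auto

lemma orb_shift:
  assumes "g \<in> carrier G"
  shows "orb (shift G g x) = orb x"
proof (intro equalityI subsetI)
  fix y assume "y \<in> orb (shift G g x)"
  then show "y \<in> orb x" using assms by (auto simp: shift_shift)
next
  fix y assume "y \<in> orb x"
  then obtain h where h: "h \<in> carrier G" "y = shift G h x" by auto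
  then have "y = shift G (h \<otimes> inv g) (shift G g x)" using assms by (simp add: shift_shift m_assoc)
  then show "y \<in> orb (shift G g x)" using h assms by auto
qed

lemma orb_closed:
  assumes x: "x \<in> free_part G n" and u: "u \<in> orb x" "(u, v) \<in> schreier_edges G S n \<or> (v, u) \<in> schreier_edges G S n"
  shows "v \<in> orb x"
proof -
  have self: "z \<in> orb z" if "z \<in> free_part G n" for z
    using shift_one[OF free_part_space[OF that]] by (intro image_eqI[of _ _ \<one>]) auto
  have "u \<in> free_part G n" "v \<in> free_part G n" using u(2) by (auto simp: schreier_edges_def)
  moreover have "orb v = orb u"
  proof -
    from u(2) obtain s where "s \<in> S" "v = shift G s u \<or> u = shift G s v"
      by (auto simp: schreier_edges_def)
    then show ?thesis using orb_shift S_sub by (metis subsetD)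
  qed
  moreover have "orb u = orb x"
  proof -
    from u(1) obtain g where "g \<in> carrier G" "u = shift G g x" by blast
    then show ?thesis by (simp only: orb_shift)
  qed
  ultimately show ?thesis using self[of v] by simp
qed

lemma orb_eq_or_disjoint: "orb x = orb y \<or> orb x \<inter> orb y = {}"
proof (rule disjCI)
  assume "orb x \<inter> orb y \<noteq> {}"
  then obtain g h where "g \<in> carrier G" "h \<in> carrier G" "shift G g x = shift G h y" by auto
  then show "orb x = orb y" using orb_shift by metis
qed

text \<open>The map g.y \<mapsto> \<gamma>(g).x is an isomorphism between two orbits, so colors can
  agree along it only if it is the identity. With \<gamma> = id this yields injectivity of the
  coding map, with \<gamma> in the stabilizer it yields triviality of \<gamma>.\<close>

lemma distinguishing_orbits:
  assumes dist: "\<forall>\<psi>\<in>graph_aut (free_part G n) (schreier_edges G S n).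
      (\<forall>x\<in>free_part G n. c (\<psi> x) = c x) \<longrightarrow> \<psi> = (\<lambda>x\<in>free_part G n. x)"
    and x: "x \<in> free_part G n" and y: "y \<in> free_part G n"
    and \<gamma>: "\<gamma> \<in> graph_aut (carrier G) (cayley_edges G S)"
    and c: "\<And>g. g \<in> carrier G \<Longrightarrow> c (shift G (\<gamma> g) x) = c (shift G g y)"
    and g: "g \<in> carrier G"
  shows "shift G (\<gamma> g) x = shift G g y"
proof -
  have bij\<gamma>: "bij_betw \<gamma> (carrier G) (carrier G)" using \<gamma> by (simp add: graph_aut_def Bij_def)
  then have \<gamma>G: "\<gamma> h \<in> carrier G" if "h \<in> carrier G" for h using that by (auto dest: bij_betwE)
  have bijo: "bij_betw (\<lambda>g. shift G g z) (carrier G) (orb z)" if "z \<in> free_part G n" for z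
    using free_part_shift_inj[OF that] by (intro inj_on_imp_bij_betw inj_onI)
  define e where "e = inv_into (carrier G) (\<lambda>g. shift G g y)"
  have bije: "bij_betw e (orb y) (carrier G)"
    unfolding e_def by (rule bij_betw_inv_into[OF bijo[OF y]])
  have e: "e (shift G h y) = h" if "h \<in> carrier G" for h
    unfolding e_def using bij_betw_inv_into_left[OF bijo[OF y] that] .
  define \<alpha> where "\<alpha> = (\<lambda>g. shift G g x) \<circ> \<gamma> \<circ> e"
  have \<alpha>: "\<alpha> (shift G h y) = shift G (\<gamma> h) x" if "h \<in> carrier G" for h
    using e[OF that] by (simp add: \<alpha>_def)
  have "\<alpha> (shift G g y) = shift G g y"
  proof (rule distinguishing_isomorphic_components[OF dist, where U = "orb y" and W = "orb x"])
    show "bij_betw \<alpha> (orb y) (orb x)"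
      unfolding \<alpha>_def by (rule bij_betw_trans[OF bije bij_betw_trans[OF bij\<gamma> bijo[OF x]]])
    show "(\<alpha> u, \<alpha> v) \<in> schreier_edges G S n \<longleftrightarrow> (u, v) \<in> schreier_edges G S n"
      if "u \<in> orb y" "v \<in> orb y" for u v
      using that \<alpha> \<gamma> \<gamma>G schreier_edge_iff[OF x] schreier_edge_iff[OF y]
      by (auto simp: graph_aut_def)
    show "c (\<alpha> u) = c u" if "u \<in> orb y" for u
      using that \<alpha> c by auto
    show "orb y = orb x \<or> orb y \<inter> orb x = {}" by (rule orb_eq_or_disjoint)
  qed (use g x y orb_subset orb_closed in auto)
  then show ?thesis using \<alpha>[OF g] by simp
qed

text \<open>By freeness a generator moves every point, so x and s.x are joined by an edge and have
  images in one orbit. Induction over the generated subgroup does the rest; quantifying over all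
  \<open>x\<close> lets the hypothesis for one factor be used at a shifted point.\<close>

lemma aut_maps_orbit:
  assumes \<psi>: "\<psi> \<in> graph_aut (free_part G n) (schreier_edges G S n)"
    and g: "g \<in> carrier G"
  shows "\<forall>x\<in>free_part G n. \<psi> (shift G g x) \<in> orb (\<psi> x)"
proof -
  have \<psi>X: "\<psi> x \<in> free_part G n" if "x \<in> free_part G n" for x
    using \<psi> that by (auto simp: graph_aut_def Bij_def dest: bij_betwE)
  have step: "\<forall>x\<in>free_part G n. \<psi> (shift G s x) \<in> orb (\<psi> x)" if s: "s \<in> S" for s
  proof
    fix x assume x: "x \<in> free_part G n"
    have sG: "s \<in> carrier G" "s \<noteq> \<one>" using s S_sub S_one by auto
    have "shift G s x \<noteq> x" using x sG by (auto simp: free_part_def)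
    then have "(x, shift G s x) \<in> schreier_edges G S n"
      using x s free_part_shift[OF x sG(1)] by (auto simp: schreier_edges_def)
    then have "(\<psi> x, \<psi> (shift G s x)) \<in> schreier_edges G S n"
      using \<psi> x free_part_shift[OF x sG(1)] by (auto simp: graph_aut_def)
    then obtain t where "t \<in> S" "shift G t (\<psi> x) = \<psi> (shift G s x)" by (auto simp: schreier_edges_def)
    then show "\<psi> (shift G s x) \<in> orb (\<psi> x)" using S_sub by (intro image_eqI[of _ _ t]) auto
  qed
  from g have "g \<in> generate G S" by (simp add: gen)
  then show ?thesis
  proof induction
    case one
    show ?case
    proof
      fix x assume x: "x \<in> free_part G n"
      show "\<psi> (shift G \<one> x) \<in> orb (\<psi> x)"
        using shift_one[OF free_part_space[OF x]] shift_one[OF free_part_space[OF \<psi>X[OF x]]]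
        by (intro image_eqI[of _ _ \<one>]) auto
    qed
  next
    case (incl h) then show ?case by (rule step)
  next
    case (inv h) then show ?case by (intro step S_inv)
  next
    case (eng h k)
    have hk: "h \<in> carrier G" "k \<in> carrier G" using eng gen by auto
    show ?case
    proof
      fix x assume x: "x \<in> free_part G n"
      have "\<psi> (shift G h (shift G k x)) \<in> orb (\<psi> (shift G k x))"
        using eng.IH(1) free_part_shift[OF x hk(2)] by blast
      also have "orb (\<psi> (shift G k x)) = orb (\<psi> x)"
      proof -
        from eng.IH(2) x obtain g where "g \<in> carrier G" "\<psi> (shift G k x) = shift G g (\<psi> x)" by blast
        then show ?thesis by (simp only: orb_shift)
      qed
      finally show "\<psi> (shift G (h \<otimes> k) x) \<in> orb (\<psi> x)" using hk by (simp add: shift_shift)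
    qed
  qed
qed

text \<open>Read in the orbit coordinates based at \<open>x\<close> and \<open>\<psi> x\<close>, the
  automorphism becomes a Cayley graph automorphism fixing the identity. That one is trivial by
  assumption, which is exactly equivariance.\<close>

lemma aut_equivariant:
  assumes triv: "cayley_stabilizer G S = {\<lambda>g\<in>carrier G. g}"
    and \<psi>: "\<psi> \<in> graph_aut (free_part G n) (schreier_edges G S n)"
    and x: "x \<in> free_part G n" and g: "g \<in> carrier G"
  shows "\<psi> (shift G g x) = shift G g (\<psi> x)"
proof -
  let ?X = "free_part G n" and ?E = "schreier_edges G S n"
  have bij: "bij_betw \<psi> ?X ?X" using \<psi> by (simp add: graph_aut_def Bij_def)
  have \<psi>X: "\<psi> z \<in> ?X" if "z \<in> ?X" for z
    using bij that by (auto dest: bij_betwE)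
  note \<psi>x = \<psi>X[OF x]
  \<comment> \<open>The inverse automorphism also maps orbits into orbits; this gives surjectivity
    of the induced map on the group.\<close>
  define \<psi>' where "\<psi>' = (\<lambda>z\<in>?X. inv_into ?X \<psi> z)"
  have \<psi>'1: "\<psi> (\<psi>' z) = z" "\<psi>' z \<in> ?X" if "z \<in> ?X" for z
    using that bij_betw_inv_into_right[OF bij that] bij_betw_inv_into[OF bij]
    by (auto simp: \<psi>'_def dest: bij_betwE)
  have \<psi>'2: "\<psi>' (\<psi> z) = z" if "z \<in> ?X" for z
    using that \<psi>X bij_betw_inv_into_left[OF bij that] by (simp add: \<psi>'_def)
  have "\<psi>' \<in> Bij ?X" unfolding \<psi>'_def using \<psi> by (intro restrict_inv_into_Bij) (simp add: graph_aut_def)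
  moreover have "(\<psi>' u, \<psi>' v) \<in> ?E \<longleftrightarrow> (u, v) \<in> ?E" if "u \<in> ?X" "v \<in> ?X" for u v
  proof -
    have "(\<psi> (\<psi>' u), \<psi> (\<psi>' v)) \<in> ?E \<longleftrightarrow> (\<psi>' u, \<psi>' v) \<in> ?E"
      using \<psi> \<psi>'1(2) that by (simp add: graph_aut_def)
    then show ?thesis using \<psi>'1(1) that by simp
  qed
  ultimately have \<psi>': "\<psi>' \<in> graph_aut ?X ?E" by (simp add: graph_aut_def)
  have "\<forall>h\<in>carrier G. \<exists>k\<in>carrier G. \<psi> (shift G h x) = shift G k (\<psi> x)"
    using aut_maps_orbit[OF \<psi>] x by blast
  then obtain k where k: "\<And>h. h \<in> carrier G \<Longrightarrow> k h \<in> carrier G"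
      "\<And>h. h \<in> carrier G \<Longrightarrow> \<psi> (shift G h x) = shift G (k h) (\<psi> x)"
    by metis
  define \<gamma> where "\<gamma> = restrict k (carrier G)"
  have "bij_betw \<gamma> (carrier G) (carrier G)"
  proof (rule bij_betw_imageI)
    show "inj_on \<gamma> (carrier G)"
    proof (rule inj_onI)
      fix h h' assume h: "h \<in> carrier G" "h' \<in> carrier G" "\<gamma> h = \<gamma> h'"
      then have "\<psi> (shift G h x) = \<psi> (shift G h' x)" using k by (simp add: \<gamma>_def)
      then have "shift G h x = shift G h' x" using \<psi>'2 free_part_shift[OF x] h by metis
      then show "h = h'" using free_part_shift_inj[OF x] h by blast
    qed
    show "\<gamma> ` carrier G = carrier G"
    proof
      show "\<gamma> ` carrier G \<subseteq> carrier G" using k by (auto simp: \<gamma>_def)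
      show "carrier G \<subseteq> \<gamma> ` carrier G"
      proof
        fix h assume h: "h \<in> carrier G"
        have "\<psi>' (shift G h (\<psi> x)) \<in> orb x"
          using aut_maps_orbit[OF \<psi>' h] \<psi>x \<psi>'2[OF x] by auto
        then obtain l where l: "l \<in> carrier G" "\<psi>' (shift G h (\<psi> x)) = shift G l x" by auto
        then have "shift G h (\<psi> x) = shift G (k l) (\<psi> x)"
          using k \<psi>'1(1)[OF free_part_shift[OF \<psi>x h]] by metis
        then have "h = k l" using free_part_shift_inj[OF \<psi>x h k(1)[OF l(1)]] by simp
        then show "h \<in> \<gamma> ` carrier G" using l by (auto simp: \<gamma>_def)
      qed
    qed
  qed
  then have "\<gamma> \<in> Bij (carrier G)" by (simp add: Bij_def \<gamma>_def)
  moreover have "(\<gamma> h, \<gamma> h') \<in> cayley_edges G S \<longleftrightarrow> (h, h') \<in> cayley_edges G S"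
    if h: "h \<in> carrier G" "h' \<in> carrier G" for h h'
  proof -
    have "(\<gamma> h, \<gamma> h') \<in> cayley_edges G S \<longleftrightarrow> (\<psi> (shift G h x), \<psi> (shift G h' x)) \<in> ?E"
      using h k schreier_edge_iff[OF \<psi>x] by (simp add: \<gamma>_def)
    also have "\<dots> \<longleftrightarrow> (shift G h x, shift G h' x) \<in> ?E"
      using \<psi> h free_part_shift[OF x] by (simp add: graph_aut_def)
    also have "\<dots> \<longleftrightarrow> (h, h') \<in> cayley_edges G S" using schreier_edge_iff[OF x h] .
    finally show ?thesis .
  qed
  moreover have "\<gamma> \<one> = \<one>"
  proof -
    have "shift G (k \<one>) (\<psi> x) = shift G \<one> (\<psi> x)"
      using k(2)[OF one_closed] shift_one[OF free_part_space[OF x]] shift_one[OF free_part_space[OF \<psi>x]]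
      by simp
    then have "k \<one> = \<one>" using free_part_shift_inj[OF \<psi>x] k(1) by blast
    then show ?thesis by (simp add: \<gamma>_def)
  qed
  ultimately have "\<gamma> \<in> cayley_stabilizer G S" by (simp add: cayley_stabilizer_def graph_aut_def)
  then have "\<gamma> = (\<lambda>g\<in>carrier G. g)" using triv by simp
  then have "k g = g" using g by (metis \<gamma>_def restrict_apply')
  then show ?thesis using k(2)[OF g] by simp
qed

text \<open>The symbol of a point at \<open>g\<close> is the color of its shift by \<open>g\<close>,
  so an equivariant color-preserving map fixes every coordinate.\<close>

lemma identity_coordinate_distinguishing:
  assumes triv: "cayley_stabilizer G S = {\<lambda>g\<in>carrier G. g}"
    and \<psi>: "\<psi> \<in> graph_aut (free_part G n) (schreier_edges G S n)"
    and col: "\<And>x. x \<in> free_part G n \<Longrightarrow> \<psi> x \<one> = x \<one>"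
  shows "\<psi> = (\<lambda>x\<in>free_part G n. x)"
proof
  fix x
  show "\<psi> x = (\<lambda>x\<in>free_part G n. x) x"
  proof (cases "x \<in> free_part G n")
    case True
    have \<psi>x: "\<psi> x \<in> free_part G n"
      using \<psi> True by (auto simp: graph_aut_def Bij_def dest: bij_betwE)
    have "\<psi> x g = x g" for g
    proof (cases "g \<in> carrier G")
      case g: True
      have "\<psi> x g = shift G g (\<psi> x) \<one>" using g by (simp add: shift_apply)
      also have "\<dots> = \<psi> (shift G g x) \<one>" using aut_equivariant[OF triv \<psi> True g] by simp
      also have "\<dots> = x g" using col[OF free_part_shift[OF True g]] g by (simp add: shift_apply)
      finally show ?thesis .
    next
      case False
      then show ?thesis using free_part_space[OF True] free_part_space[OF \<psi>x]
        by (auto simp: space_full_shift space_bernoulli PiE_iff extensional_def)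
    qed
    then show ?thesis using True by (simp add: fun_eq_iff)
  next
    case False
    then show ?thesis using \<psi> by (auto simp: graph_aut_def Bij_def extensional_def)
  qed
qed

end

section \<open>Finite distinguishing colorings\<close>

text \<open>A metrizable topology on a finite set is discrete, so any renaming of finitely many
  colors is measurable.\<close>

lemma standard_borel_space_finite_sets:
  assumes "standard_borel_space Y" "finite (space Y)"
  shows "sets Y = Pow (space Y)"
proof (rule antisym)
  show "sets Y \<subseteq> Pow (space Y)" using sets.space_closed .
  obtain T where T: "completely_metrizable_space T" "topspace T = space Y"
      "sets Y = sigma_sets (space Y) {U. openin T U}"
    using assms(1) unfolding standard_borel_space_def by blast
  have t1: "t1_space T"
    using T(1) completely_metrizable_imp_metrizable_space metrizable_imp_Hausdorff_space
      Hausdorff_imp_t1_space by blast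
  have "openin T U" if "U \<subseteq> space Y" for U
  proof -
    have "closedin T (space Y - U)"
      using t1 assms(2) T(2) by (simp add: t1_space_closedin_finite)
    then show ?thesis using that T(2) by (simp add: openin_closedin_eq)
  qed
  then show "Pow (space Y) \<subseteq> sets Y" unfolding T(3) by (auto intro: sigma_sets.Basic)
qed

lemma standard_borel_space_count_space:
  assumes "countable A" shows "standard_borel_space (count_space A)"
  unfolding standard_borel_space_def
proof (intro exI[of _ "discrete_topology A"] conjI)
  show "sets (count_space A) = sigma_sets (space (count_space A)) {U. openin (discrete_topology A) U}"
    using sigma_sets_into_sp[of "{U. U \<subseteq> A}" A] by (auto intro: sigma_sets.Basic)
qed (simp_all add: assms completely_metrizable_space_discrete_topology second_countable_discrete_topology)

lemma standard_borel_space_borel: "standard_borel_space (borel :: 'p :: polish_space measure)"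
proof -
  obtain \<B> :: "'p set set" where \<B>: "countable \<B>" "topological_basis \<B>"
    using ex_countable_basis by blast
  have "second_countable (euclidean :: 'p topology)"
    unfolding second_countable_def
  proof (intro exI[of _ \<B>] conjI allI impI ballI)
    show "countable \<B>" by fact
    show "openin euclidean V" if "V \<in> \<B>" for V
      using that \<B>(2) topological_basis_open by auto
    show "\<exists>V\<in>\<B>. x \<in> V \<and> V \<subseteq> U" if "openin euclidean U \<and> x \<in> U" for U x
      using that topological_basisE[OF \<B>(2), of U x] by (metis open_openin)
  qed
  then show ?thesis
    unfolding standard_borel_space_def
    by (intro exI[of _ euclidean]) (simp add: completely_metrizable_space_euclidean sets_borel)
qed

text \<open>One existing coloring, over any type of colors, guarantees that the minimum is attained.
  An attaining color space that is infinite exceeds every finite \<open>m\<close>, so only finite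
  ones have to be bounded.\<close>

lemma card_le_borel_distinguishing_number:
  assumes ex: "borel_distinguishing_coloring M E (Y0 :: 'y measure) c0"
    and ge: "\<And>(Y :: real measure) c. borel_distinguishing_coloring M E Y c \<Longrightarrow> finite (space Y)
      \<Longrightarrow> m \<le> card (space Y)"
  shows "|{..<m}| \<le>o borel_distinguishing_number M E"
proof -
  obtain Y1 :: "real measure" and c1 where "borel_distinguishing_coloring M E Y1 c1"
    using borel_distinguishing_coloring_real[OF ex] by blast
  from borel_distinguishing_number_props[OF this] obtain Y :: "real measure" and c
    where Y: "borel_distinguishing_coloring M E Y c" "borel_distinguishing_number M E = |space Y|"
    by blast
  obtain Z where Z: "Z \<subseteq> space Y" "finite Z" "card Z = m"
  proof (cases "finite (space Y)")
    case True
    then show thesis using that obtain_subset_with_card_n[OF ge[OF Y(1) True]] finite_subset by metis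
  next
    case False
    then show thesis using that infinite_arbitrarily_large by blast
  qed
  have "card {..<m} = card Z" using Z by simp
  from finite_same_card_bij[OF _ Z(2) this] obtain h where "bij_betw h {..<m} Z" by auto
  then have "inj_on h {..<m} \<and> h ` {..<m} \<subseteq> space Y" using Z(1) by (auto simp: bij_betw_def)
  then show ?thesis unfolding Y(2) using card_of_ordLeq by blast
qed

section \<open>Colorings of the free part\<close>

context cayley_generators
begin

lemma space_free_part_space: "space (free_part_space G n) = free_part G n"
  using free_part_space by (auto simp: free_part_space_def space_restrict_space)

lemma measurable_free_part_space:
  assumes "f \<in> bernoulli (carrier G) n \<rightarrow>\<^sub>M N"
  shows "f \<in> free_part_space G n \<rightarrow>\<^sub>M N"
  unfolding free_part_space_def
  using assms by (intro measurable_restrict_space1) (simp add: measurable_cong_sets[OF sets_full_shift refl])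

text \<open>Giving all points different colors shows that some distinguishing coloring exists, so
  that the minimum defining the number is taken over a nonempty family.\<close>

lemma injective_distinguishing_coloring:
  assumes "countable (carrier G)"
  shows "borel_distinguishing_coloring (free_part_space G n) E borel (to_seq (carrier G))"
  unfolding borel_distinguishing_coloring_def space_free_part_space
proof (intro conjI ballI impI)
  show "standard_borel_space (borel :: (nat \<Rightarrow> real) measure)" by (rule standard_borel_space_borel)
  show "to_seq (carrier G) \<in> free_part_space G n \<rightarrow>\<^sub>M borel"
    by (intro measurable_free_part_space measurable_to_seq) auto
  fix \<psi> assume \<psi>: "\<psi> \<in> graph_aut (free_part G n) E" "\<psi> \<noteq> (\<lambda>x\<in>free_part G n. x)"
  then obtain x where x: "x \<in> free_part G n" "\<psi> x \<noteq> x"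
    by (auto simp: graph_aut_def Bij_def extensional_def fun_eq_iff restrict_def split: if_splits)
  have "\<psi> x \<in> free_part G n" using \<psi>(1) x(1) by (auto simp: graph_aut_def Bij_def dest: bij_betwE)
  then have "to_seq (carrier G) (\<psi> x) \<noteq> to_seq (carrier G) x"
    using inj_to_seq[OF assms, of "\<psi> x" n x] x free_part_space by (auto simp: space_full_shift)
  then show "\<exists>x\<in>free_part G n. to_seq (carrier G) (\<psi> x) \<noteq> to_seq (carrier G) x" using x(1) by blast
qed

lemma identity_coordinate_coloring:
  assumes "cayley_stabilizer G S = {\<lambda>g\<in>carrier G. g}"
  shows "borel_distinguishing_coloring (free_part_space G n) (schreier_edges G S n)
    (count_space {..<n}) (\<lambda>x. x \<one>)"
  unfolding borel_distinguishing_coloring_def space_free_part_space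
proof (intro conjI ballI impI)
  show "standard_borel_space (count_space {..<n})" by (rule standard_borel_space_count_space) simp
  show "(\<lambda>x. x \<one>) \<in> free_part_space G n \<rightarrow>\<^sub>M count_space {..<n}"
    by (intro measurable_free_part_space measurable_bernoulli_component) simp
  fix \<psi> assume "\<psi> \<in> graph_aut (free_part G n) (schreier_edges G S n)" "\<psi> \<noteq> (\<lambda>x\<in>free_part G n. x)"
  then show "\<exists>x\<in>free_part G n. \<psi> x \<one> \<noteq> x \<one>"
    using identity_coordinate_distinguishing[OF assms] by blast
qed

text \<open>The first conclusion gives the lower bound n; the second, read contrapositively, gives n
  + 1 when the stabilizer is non-trivial.\<close>

theorem finite_distinguishing_coloring:
  assumes count: "countable (carrier G)" and inf: "infinite (carrier G)" and amen: "amenable_group G"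
    and n: "n \<ge> 2"
    and col: "borel_distinguishing_coloring (free_part_space G n) (schreier_edges G S n) Y c"
    and Y: "finite (space Y)" "card (space Y) \<le> n"
  shows "card (space Y) = n" "cayley_stabilizer G S = {\<lambda>g\<in>carrier G. g}"
proof -
  let ?B = "bernoulli (carrier G) n" and ?X = "free_part G n"
  have n0: "n > 0" using n by simp
  interpret prob_space ?B using n0 by (rule prob_space_bernoulli)
  have sb: "standard_borel_space Y" and c: "c \<in> free_part_space G n \<rightarrow>\<^sub>M Y"
    and dist: "\<forall>\<psi>\<in>graph_aut ?X (schreier_edges G S n). (\<forall>x\<in>?X. c (\<psi> x) = c x) \<longrightarrow> \<psi> = (\<lambda>x\<in>?X. x)"
    using col unfolding borel_distinguishing_coloring_def space_free_part_space by blast+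
  have cY: "c x \<in> space Y" if "x \<in> ?X" for x
    using measurable_space[OF c] that by (simp add: space_free_part_space)
  obtain i where i: "bij_betw i (space Y) {..<card (space Y)}"
    using ex_bij_betw_finite_nat[OF Y(1)] by (auto simp: atLeast0LessThan)
  have iY: "i y < card (space Y)" if "y \<in> space Y" for y using i that by (auto dest: bij_betwE)
  \<comment> \<open>The colors are renamed to an initial segment of the naturals, and the coloring
    is extended by 0 to the whole shift space. The complement of the free part is null, so the
    extension costs nothing.\<close>
  define d where "d x = (if x \<in> ?X then i (c x) else 0)" for x
  have X: "?X \<in> events" by (rule free_part_sets[OF count])
  have X1: "prob ?X = 1" by (rule measure_free_part[OF count inf n])
  have "i \<in> Y \<rightarrow>\<^sub>M count_space {..<n}"
  proof (rule measurableI)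
    show "i y \<in> space (count_space {..<n})" if "y \<in> space Y" for y
      using iY[OF that] Y(2) by simp
    show "i -` A \<inter> space Y \<in> sets Y" for A
      unfolding standard_borel_space_finite_sets[OF sb Y(1)] by auto
  qed
  then have "(\<lambda>x. i (c x)) \<in> restrict_space (full_shift G n) ?X \<rightarrow>\<^sub>M count_space {..<n}"
    using c unfolding free_part_space_def by (rule measurable_compose[rotated])
  then have "d \<in> full_shift G n \<rightarrow>\<^sub>M count_space {..<n}"
    unfolding d_def
    by (subst measurable_restrict_space_iff[symmetric])
      (use X n0 in \<open>auto simp: sets_full_shift\<close>)
  then have d: "d \<in> ?B \<rightarrow>\<^sub>M count_space {..<n}"
    by (simp add: measurable_cong_sets[OF sets_full_shift refl])
  define f where "f x = (\<lambda>g\<in>carrier G. d (shift G g x))" for x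
  have f: "f \<in> ?B \<rightarrow>\<^sub>M ?B"
    unfolding f_def
    by (intro measurable_to_bernoulli measurable_compose[OF measurable_shift d])
  have equi: "f (shift G g x) = shift G g (f x)" if "g \<in> carrier G" for g x
    using that by (auto simp: f_def fun_eq_iff shift_shift shift_def[of G g "\<lambda>h\<in>carrier G. d (shift G h x)"])
  have c_eq: "c x = c y" if "x \<in> ?X" "y \<in> ?X" "d x = d y" for x y
    using that i cY by (auto simp: d_def bij_betw_def dest: inj_onD)
  have orbits: "shift G (\<gamma> g) x = shift G g y"
    if "x \<in> ?X" "y \<in> ?X" "\<gamma> \<in> graph_aut (carrier G) (cayley_edges G S)"
      "\<And>g. g \<in> carrier G \<Longrightarrow> f y g = f x (\<gamma> g)" "g \<in> carrier G" for x y \<gamma> g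
  proof (rule distinguishing_orbits[OF dist that(1-3) _ that(5)])
    fix h assume h: "h \<in> carrier G"
    have \<gamma>h: "\<gamma> h \<in> carrier G" using that(3) h by (auto simp: graph_aut_def Bij_def dest: bij_betwE)
    show "c (shift G (\<gamma> h) x) = c (shift G h y)"
      using that(4)[OF h] h \<gamma>h by (intro c_eq free_part_shift that(1,2)) (auto simp: f_def)
  qed
  have inj: "inj_on f ?X"
  proof (rule inj_onI)
    fix x y assume xy: "x \<in> ?X" "y \<in> ?X" "f x = f y"
    have "(\<lambda>g\<in>carrier G. g) \<in> graph_aut (carrier G) (cayley_edges G S)"
      by (simp add: graph_aut_def id_Bij)
    from orbits[OF xy(1,2) this _ one_closed] xy(3) show "x = y"
      using shift_one[OF free_part_space] xy by simp
  qed
  have distr: "distr ?B ?B f = ?B"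
    by (rule equivariant_injection_preserves_bernoulli[OF amen count n0 X X1 f inj equi])
  show "card (space Y) = n"
  proof (rule ccontr)
    assume "card (space Y) \<noteq> n"
    then have less: "card (space Y) \<le> n - 1" using Y(2) by simp
    \<comment> \<open>With fewer than n colors the symbol n - 1 is not a color, so on the free part
      it never appears at the identity in f x; yet its cylinder has mass 1/n.\<close>
    define u where "u = (\<lambda>h\<in>{\<one>}. n - 1)"
    have u: "u \<in> (\<Pi>\<^sub>E i\<in>{\<one>}. {..<n})" using n0 by (auto simp: u_def)
    let ?C = "{x \<in> space ?B. restrict x {\<one>} = u}"
    have C: "?C \<in> events"
      using measurable_sets[OF measurable_bernoulli_restrict[of "{\<one>}" "carrier G" n], of "{u}"] u
      by (simp add: vimage_def Int_def conj_commute)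
    have "1 / real n = prob ?C"
      using measure_bernoulli_cylinder[OF n0 _ _ u, of "carrier G"] by simp
    also have "\<dots> = measure (distr ?B ?B f) ?C" by (simp add: distr)
    also have "\<dots> = prob (f -` ?C \<inter> space ?B)" by (rule measure_distr[OF f C])
    also have "\<dots> \<le> prob (space ?B - ?X)"
    proof (rule finite_measure_mono)
      show "f -` ?C \<inter> space ?B \<subseteq> space ?B - ?X"
      proof
        fix x assume x: "x \<in> f -` ?C \<inter> space ?B"
        have "x \<notin> ?X"
        proof
          assume xX: "x \<in> ?X"
          have "f x \<one> = u \<one>" using x by (auto simp: fun_eq_iff restrict_def split: if_splits)
          then have "i (c x) = n - 1"
            using xX shift_one[OF free_part_space[OF xX]] by (simp add: f_def d_def u_def)
          then show False using iY[OF cY[OF xX]] less by simp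
        qed
        then show "x \<in> space ?B - ?X" using x by simp
      qed
    qed (use X in auto)
    also have "\<dots> = 0" using X X1 by (simp add: prob_compl)
    finally show False using n0 by simp
  qed
  have "\<gamma> = (\<lambda>g\<in>carrier G. g)" if \<gamma>: "\<gamma> \<in> cayley_stabilizer G S" for \<gamma>
  proof -
    have \<gamma>a: "\<gamma> \<in> graph_aut (carrier G) (cayley_edges G S)" "\<gamma> \<one> = \<one>"
      using \<gamma> by (auto simp: cayley_stabilizer_def)
    then have bij: "bij_betw \<gamma> (carrier G) (carrier G)" by (simp add: graph_aut_def Bij_def)
    then have \<gamma>G: "\<gamma> g \<in> carrier G" if "g \<in> carrier G" for g using that by (auto dest: bij_betwE)
    have ne: "carrier G \<noteq> {}" by auto
    let ?s = "to_seq (carrier G)"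
    obtain K where K: "compact K" "K \<subseteq> (\<lambda>x. (?s x, ?s (f x))) ` ?X"
      "prob {x \<in> space ?B. (?s x, ?s (f x)) \<in> K} > 1 - 1 / 2"
      using compact_subgraph[OF n0 count ne X X1 f, of "1/2"] by auto
    \<comment> \<open>Every point of \<open>L\<close> is the image of a point of the free part, and
      \<open>L\<close> is measurable because the projection of the compact \<open>K\<close> is
      compact. Mass above 1/2 suffices for two such sets to meet.\<close>
    define L where "L = ?s -` (snd ` K) \<inter> space ?B"
    have "compact (snd ` K)" using K(1) by (intro compact_continuous_image continuous_intros)
    then have L: "L \<in> events"
      unfolding L_def by (intro measurable_sets[OF measurable_to_seq[OF ne]] borel_compact)
    have "1 / 2 < prob {x \<in> space ?B. (?s x, ?s (f x)) \<in> K}" using K(3) by simp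
    also have "\<dots> \<le> prob (f -` L \<inter> space ?B)"
      using measurable_space[OF f] by (intro finite_measure_mono measurable_sets[OF f L]) (force simp: L_def)
    also have "\<dots> = measure (distr ?B ?B f) L" by (rule measure_distr[OF f L, symmetric])
    also have "\<dots> = prob L" by (simp add: distr)
    finally have L2: "prob L > 1 / 2" .
    \<comment> \<open>Precomposition with \<gamma> permutes the coordinates and hence preserves the
      measure, so \<open>L\<close> and its preimage under \<open>p\<close> have equal mass.\<close>
    define p where "p y = (\<lambda>g\<in>carrier G. y (\<gamma> g))" for y :: "'a \<Rightarrow> nat"
    have p: "p \<in> ?B \<rightarrow>\<^sub>M ?B"
      unfolding p_def using \<gamma>G by (intro measurable_to_bernoulli measurable_bernoulli_component)
    have dp: "distr ?B ?B p = ?B"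
      unfolding p_def using bij \<gamma>G by (intro bernoulli_reindex[OF n0]) (auto simp: bij_betw_def)
    have pL: "p -` L \<inter> space ?B \<in> events" by (rule measurable_sets[OF p L])
    have "prob (p -` L \<inter> space ?B) = prob L"
      using measure_distr[OF p L] by (simp add: dp)
    have "L \<inter> (p -` L \<inter> space ?B) \<noteq> {}"
    proof
      assume "L \<inter> (p -` L \<inter> space ?B) = {}"
      then have "prob (L \<union> (p -` L \<inter> space ?B)) = prob L + prob (p -` L \<inter> space ?B)"
        using L pL by (intro finite_measure_Union)
      then show False
        using prob_le_1[of "L \<union> (p -` L \<inter> space ?B)"] L2 \<open>prob (p -` L \<inter> space ?B) = prob L\<close> by linarith
    qed
    then obtain y where y: "y \<in> L" "p y \<in> L" by auto
    have preimage: "\<exists>x\<in>?X. z = f x" if z: "z \<in> L" for z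
    proof -
      from z obtain w where w: "w \<in> K" "?s z = snd w" "z \<in> space ?B" by (auto simp: L_def)
      then obtain x where x: "x \<in> ?X" "?s z = ?s (f x)" using K(2) by auto
      then have "f x \<in> space ?B"
        using measurable_space[OF f] free_part_space[of x n] by (simp add: space_full_shift)
      with inj_to_seq[OF count w(3)] x show ?thesis by blast
    qed
    obtain x where x: "x \<in> ?X" "y = f x" using preimage[OF y(1)] by blast
    obtain x' where x': "x' \<in> ?X" "p y = f x'" using preimage[OF y(2)] by blast
    have "f x' g = f x (\<gamma> g)" if "g \<in> carrier G" for g
      using that x(2) x'(2)[symmetric] by (simp add: p_def)
    from orbits[OF x(1) x'(1) \<gamma>a(1) this] have eq: "shift G (\<gamma> g) x = shift G g x'" if "g \<in> carrier G" for g
      using that by blast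
    \<comment> \<open>Evaluating at the identity, which \<gamma> fixes, identifies the base points;
      freeness then turns \<gamma>(g).x = g.x into \<gamma>(g) = g.\<close>
    have "x = x'" using eq[OF one_closed] \<gamma>a(2) shift_one[OF free_part_space] x(1) x'(1) by simp
    then have "\<gamma> g = g" if "g \<in> carrier G" for g
      using free_part_shift_inj[OF x(1) \<gamma>G[OF that] that] eq[OF that] by simp
    moreover have "\<gamma> \<in> extensional (carrier G)" using \<gamma>a(1) by (simp add: graph_aut_def Bij_def)
    ultimately show ?thesis by (auto simp: fun_eq_iff extensional_def)
  qed
  moreover have "(\<lambda>g\<in>carrier G. g) \<in> cayley_stabilizer G S"
    by (simp add: cayley_stabilizer_def graph_aut_def id_Bij)
  ultimately show "cayley_stabilizer G S = {\<lambda>g\<in>carrier G. g}" by blast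
qed

end

theorem theorem1p2:
  fixes \<Gamma> :: "('g, 'b) monoid_scheme" and S :: "'g set" and n :: nat
  assumes "group \<Gamma>"
    and "countable (carrier \<Gamma>)" and "infinite (carrier \<Gamma>)"
    and "amenable_group \<Gamma>"
    and "finite S" and "S \<subseteq> carrier \<Gamma>" and "generate \<Gamma> S = carrier \<Gamma>"
    and "\<forall>s\<in>S. inv\<^bsub>\<Gamma>\<^esub> s \<in> S" and "\<one>\<^bsub>\<Gamma>\<^esub> \<notin> S"
    and "n \<ge> 2"
  shows "(cayley_stabilizer \<Gamma> S = {\<lambda>g\<in>carrier \<Gamma>. g} \<longrightarrow>
            borel_distinguishing_number (free_part_space \<Gamma> n) (schreier_edges \<Gamma> S n) =o |{..<n}| ) \<and>
         (cayley_stabilizer \<Gamma> S \<noteq> {\<lambda>g\<in>carrier \<Gamma>. g} \<longrightarrow>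
            |{..<n + 1}| \<le>o borel_distinguishing_number (free_part_space \<Gamma> n) (schreier_edges \<Gamma> S n))"
proof -
  interpret cayley_generators \<Gamma> S
    using assms by (simp add: cayley_generators_def cayley_generators_axioms_def)
  let ?M = "free_part_space \<Gamma> n" and ?E = "schreier_edges \<Gamma> S n"
  note finite_col = finite_distinguishing_coloring[OF assms(2,3,4,10)]
  note ge = card_le_borel_distinguishing_number[OF injective_distinguishing_coloring[OF assms(2)], of n ?E]
  show ?thesis
  proof (intro conjI impI)
    assume triv: "cayley_stabilizer \<Gamma> S = {\<lambda>g\<in>carrier \<Gamma>. g}"
    have "borel_distinguishing_number ?M ?E \<le>o |{..<n}|"
      using borel_distinguishing_number_le[OF identity_coordinate_coloring[OF triv, of n]] by simp
    moreover have "|{..<n}| \<le>o borel_distinguishing_number ?M ?E"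
    proof (rule ge)
      fix Y :: "real measure" and c
      assume "borel_distinguishing_coloring ?M ?E Y c" "finite (space Y)"
      then show "n \<le> card (space Y)" using finite_col(1)[of Y c] by linarith
    qed
    ultimately show "borel_distinguishing_number ?M ?E =o |{..<n}|"
      by (simp add: ordIso_iff_ordLeq)
  next
    assume nontriv: "cayley_stabilizer \<Gamma> S \<noteq> {\<lambda>g\<in>carrier \<Gamma>. g}"
    show "|{..<n + 1}| \<le>o borel_distinguishing_number ?M ?E"
    proof (rule ge)
      fix Y :: "real measure" and c
      assume "borel_distinguishing_coloring ?M ?E Y c" "finite (space Y)"
      then show "n + 1 \<le> card (space Y)" using finite_col(2)[of Y c] nontriv by linarith
    qed
  qed
qed

end
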